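(* Let $G$ be a split graph (finite, simple, connected, with at least two vertices), and let $\lambda_2(G)$ be its second largest distance eigenvalue. Then $\lambda_2(G)<-\frac{1}{2}$ if and only if one of the following holds: (i) $G\cong SP_1$ or $G\cong SP_2$; (ii) $G\cong B_6$ or $G\cong B_7$; (iii) $G\cong SP^t$ for some integer $t\ge 0$; (iv) $G\cong B^{\theta}_k$ for some integer $k\ge 0$; (v) $G\cong K_s(t)$ for some integers $s\ge 2$ and $t\ge 0$; (vi) $G\cong K_s(a,1)$ for some integer $s\ge 2$ and some $a\in\{1,2\}$; (vii) $G\cong K_s(\underbrace{1,\dots,1}_{t})$ for some integers $s\ge 3$ and $t\ge 3$ (with $t\le s$). (The graphs named here are defined in the context.)
   Context: For a connected simple graph $G$ on vertices $v_1,\dots,v_n$, $n\ge2$, the distance matrix is $D(G)=(d_G(v_i,v_j))$, where $d_G(u,v)$ is the length of a shortest path between $u$ and $v$; its eigenvalues with multiplicity are $\lambda_1(G)\ge\lambda_2(G)\ge\dots\ge\lambda_n(G)$, and $\lambda_2(G)$ is the second largest distance eigenvalue. A split graph is a graph whose vertex set can be partitioned into a clique and an independent set (equivalently, both $G$ and its complement are chordal). Attaching a pendant edge at a vertex $u$ means adding a new vertex adjacent only to $u$. $K_s(x_1,\dots,x_r)$, for $s\ge 2$ and $1\le r\le s$: obtained from the complete graph $K_s$ with vertex set $\{v_1,\dots,v_s\}$ by attaching $x_i$ pendant edges at $v_i$ for $i=1,\dots,r$. (So $K_s(0)=K_s$.) $\theta(2,2,1)$: the complete graph $K_4$ minus one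 edge; let $x,y$ be its two vertices of degree three. $B^{\theta}_k$, $k\ge 0$: obtained from $\theta(2,2,1)$ by attaching $k$ pendant edges at $x$. $B_6$: obtained from $\theta(2,2,1)$ by attaching one pendant edge at $x$ and one at $y$. $B_7$: obtained from $\theta(2,2,1)$ by attaching two pendant edges at $x$ and one at $y$. $SP^0$: obtained from $K_4$ by adding a new vertex $w$ adjacent to exactly two vertices $u,v$ of $K_4$. $SP^t$, $t\ge 0$: obtained from $SP^0$ by attaching $t$ pendant edges at $u$. $SP_1$: obtained from $SP^0$ by attaching two pendant edges at $u$ and one pendant edge at $v$. $SP_2$: obtained from $SP^0$ by attaching one pendant edge at $u$ and one pendant edge at $v$. *)

theory Defs
  imports "Graph_Theory.Graph_Theory" "Jordan_Normal_Form.Char_Poly"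
begin

text \<open>
  Finite simple graphs are rendered by the locale \<^locale>\<open>pair_graph\<close>: a finite vertex set with a
  symmetric, irreflexive adjacency relation on it.
\<close>

section \<open>Distance eigenvalues\<close>

text \<open>The library's shortest-path distance is weighted and extended-real valued; with unit weights
  the cost of a walk is its length, and the value is finite between vertices of a connected graph.\<close>

definition graph_dist :: "'a pair_pre_digraph \<Rightarrow> 'a \<Rightarrow> 'a \<Rightarrow> real" where
  "graph_dist G u v = real_of_ereal (wf_digraph.\<mu> (with_proj G) (\<lambda>_. 1) u v)"

text \<open>The list \<open>vs\<close> is the enumeration $v_1,\dots,v_n$ of the vertices.\<close>

definition distance_matrix :: "'a pair_pre_digraph \<Rightarrow> 'a list \<Rightarrow> real mat" where
  "distance_matrix G vs =
     mat (length vs) (length vs) (\<lambda>(i, j). graph_dist G (vs ! i) (vs ! j))"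

text \<open>The real roots of the characteristic polynomial, each repeated according to its multiplicity,
  in decreasing order. A real symmetric matrix of size \<open>n\<close> has exactly \<open>n\<close> of them.\<close>

definition eigenvalues_desc :: "real mat \<Rightarrow> real list" where
  "eigenvalues_desc A = rev (sorted_list_of_multiset (proots (char_poly A)))"

text \<open>List positions start at 0, so position 1 holds the second largest eigenvalue.\<close>

definition second_dist_eigenvalue :: "'a pair_pre_digraph \<Rightarrow> 'a list \<Rightarrow> real" where
  "second_dist_eigenvalue G vs = eigenvalues_desc (distance_matrix G vs) ! 1"


section \<open>Split graphs\<close>

definition is_clique :: "'a pair_pre_digraph \<Rightarrow> 'a set \<Rightarrow> bool" where
  "is_clique G C \<longleftrightarrow> C \<subseteq> pverts G \<and> (\<forall>u\<in>C. \<forall>v\<in>C. u \<noteq> v \<longrightarrow> (u, v) \<in> parcs G)"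

definition is_independent :: "'a pair_pre_digraph \<Rightarrow> 'a set \<Rightarrow> bool" where
  "is_independent G I \<longleftrightarrow> I \<subseteq> pverts G \<and> (\<forall>u\<in>I. \<forall>v\<in>I. (u, v) \<notin> parcs G)"

text \<open>Either part may be empty.\<close>

definition split_graph :: "'a pair_pre_digraph \<Rightarrow> bool" where
  "split_graph G \<longleftrightarrow>
     (\<exists>C I. is_clique G C \<and> is_independent G I \<and> C \<union> I = pverts G \<and> C \<inter> I = {})"


section \<open>The named graphs\<close>

definition complete_graph :: "nat \<Rightarrow> nat pair_pre_digraph" where
  "complete_graph s =
     \<lparr> pverts = {..<s}, parcs = {(i, j). i < s \<and> j < s \<and> i \<noteq> j} \<rparr>"

text \<open>The successor of the largest vertex serves as the new vertex.\<close>

definition attach_pendant :: "nat \<Rightarrow> nat pair_pre_digraph \<Rightarrow> nat pair_pre_digraph" where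
  "attach_pendant u G =
     (let w = Suc (Max (pverts G))
      in \<lparr> pverts = insert w (pverts G), parcs = parcs G \<union> {(u, w), (w, u)} \<rparr>)"

definition attach_pendants :: "nat \<Rightarrow> nat \<Rightarrow> nat pair_pre_digraph \<Rightarrow> nat pair_pre_digraph" where
  "attach_pendants k u G = (attach_pendant u ^^ k) G"

text \<open>$K_s(x_1,\dots,x_r)$ with $v_i$ numbered \<open>i - 1\<close>; meaningful for \<open>length xs \<le> s\<close>.\<close>

definition clique_pendants :: "nat \<Rightarrow> nat list \<Rightarrow> nat pair_pre_digraph" where
  "clique_pendants s xs =
     fold (\<lambda>i. attach_pendants (xs ! i) i) [0..<length xs] (complete_graph s)"

text \<open>In $\theta(2,2,1)$ the vertices $x$, $y$ of degree three are \<open>0\<close> and \<open>1\<close>.\<close>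

definition theta221 :: "nat pair_pre_digraph" where
  "theta221 =
     \<lparr> pverts = pverts (complete_graph 4),
       parcs = parcs (complete_graph 4) - {(2, 3), (3, 2)} \<rparr>"

definition B_theta :: "nat \<Rightarrow> nat pair_pre_digraph" where
  "B_theta k = attach_pendants k 0 theta221"

definition B6 :: "nat pair_pre_digraph" where
  "B6 = attach_pendants 1 1 (attach_pendants 1 0 theta221)"

definition B7 :: "nat pair_pre_digraph" where
  "B7 = attach_pendants 1 1 (attach_pendants 2 0 theta221)"

text \<open>In $SP^0$ the new vertex $w$ is \<open>4\<close> and its neighbours $u$, $v$ are \<open>0\<close> and \<open>1\<close>.\<close>

definition SP0 :: "nat pair_pre_digraph" where
  "SP0 =
     \<lparr> pverts = insert 4 (pverts (complete_graph 4)),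
       parcs = parcs (complete_graph 4) \<union> {(4, 0), (0, 4), (4, 1), (1, 4)} \<rparr>"

definition SP_sup :: "nat \<Rightarrow> nat pair_pre_digraph" where
  "SP_sup t = attach_pendants t 0 SP0"

definition SP1 :: "nat pair_pre_digraph" where
  "SP1 = attach_pendants 1 1 (attach_pendants 2 0 SP0)"

definition SP2 :: "nat pair_pre_digraph" where
  "SP2 = attach_pendants 1 1 (attach_pendants 1 0 SP0)"

abbreviation graph_iso :: "'a pair_pre_digraph \<Rightarrow> 'b pair_pre_digraph \<Rightarrow> bool" (infix "\<simeq>\<^sub>G" 50) where
  "G \<simeq>\<^sub>G H \<equiv> digraph_iso (with_proj G) (with_proj H)"

end

(*
  With D the distance matrix, lambda_2 < -1/2 says that the form M = 2 D + 1 is negative definite on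
  some hyperplane.  In a connected split graph all distances are at most 3 and are determined by
  adjacency, so M is explicit once a clique K, chosen maximal, and an independent set I partition
  the vertices.
  For each listed graph a suitable hyperplane turns M into minus a sum of squares.  Conversely,
  a form with M(v,v) = 1 that is negative definite on a hyperplane satisfies
  M(y,y) < M(v,y)^2 for all y that are not multiples of the unit vector v; an explicit integer
  vector y violating this excludes each of eight small configurations, and what remains is the list.
*)
theory Submission
  imports Defs "Jordan_Normal_Form.Schur_Decomposition"
begin

section \<open>The spectral theorem for real symmetric matrices\<close>

text \<open>The families in the list have unbounded parameters, so no eigenvalue is ever computed: a
  hyperplane certifies that the second eigenvalue is small, and a vector with at most six nonzero
  entries certifies that it is not. Let \<open>S\<close> be the weight of the clique plus twice the
  weight of the other vertices. Completing the square brings out \<open>2 S^2\<close> in every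
  listed form. For pendants alone the plane \<open>S = 0\<close> leaves only negative squares, but a
  vertex of weight \<open>w\<close> with two neighbours adds \<open>+ w^2\<close>. For a clique of
  four vertices the plane \<open>S = 0\<close> balances this term exactly and so is not good enough;
  the hyperplane has to be tilted. The forbidden configurations are just as tight: in seven of the
  eight, the vector gives \<open>M(y,y) = M(v,y)^2\<close>, so their certificates rest on the
  strictness of the inequality. The form is defined from adjacency alone. It therefore makes sense
  for a named graph before anything is known about distances there, and an isomorphism carries it to
  \<open>G\<close>, where it is the form of the true distances.\<close>

lemma conjugate_real_vec [simp]: "conjugate (v :: real vec) = v"
  by (intro eq_vecI) (auto simp: conjugate_real_def)

lemma complex_eigenvalue_of_real_symmetric:
  fixes A :: "real mat"
  assumes A: "A \<in> carrier_mat n n" and sym: "A\<^sup>T = A"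
    and ev: "eigenvalue (map_mat complex_of_real A) e"
  shows "e \<in> \<real>"
proof -
  define B where "B = map_mat complex_of_real A"
  have B: "B \<in> carrier_mat n n" and BT: "B\<^sup>T = B"
    using A sym by (auto simp: B_def map_mat_transpose)
  obtain v where v: "v \<in> carrier_vec n" and v0: "v \<noteq> 0\<^sub>v n" and Bv: "B *\<^sub>v v = e \<cdot>\<^sub>v v"
    using ev B unfolding eigenvalue_def eigenvector_def B_def[symmetric] by auto
  have cv: "conjugate v \<in> carrier_vec n"
    using v by simp
  have Bcv: "B *\<^sub>v conjugate v = conjugate e \<cdot>\<^sub>v conjugate v"
  proof -
    have "B *\<^sub>v conjugate v = conjugate (B *\<^sub>v v)"
    proof (rule eq_vecI)
      fix i assume "i < dim_vec (conjugate (B *\<^sub>v v))"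
      then show "(B *\<^sub>v conjugate v) $ i = conjugate (B *\<^sub>v v) $ i"
        using A v by (simp add: B_def scalar_prod_def conjugate_complex_def)
    qed simp
    then show ?thesis
      using v by (simp add: Bv conjugate_smult_vec)
  qed
  have "e * (v \<bullet>c v) = (B *\<^sub>v v) \<bullet>c v"
    using v by (simp add: Bv)
  also have "\<dots> = v \<bullet> (B *\<^sub>v conjugate v)"
    using transpose_vec_mult_scalar[OF B cv v] BT comm_scalar_prod[of v n "B *\<^sub>v conjugate v"] v cv B
    by simp
  also have "\<dots> = conjugate e * (v \<bullet>c v)"
    using v by (simp add: Bcv)
  finally have "e = cnj e"
    using v v0 conjugate_square_eq_0_vec[OF v] by (simp add: conjugate_complex_def)
  then show ?thesis
    by (metis Reals_cnj_iff)
qed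

text \<open>Over the complex numbers the characteristic polynomial splits, its roots are real by the
  preceding lemma, and the embedding of real into complex polynomials is injective, so the
  factorization descends.\<close>

lemma char_poly_real_symmetric_splits:
  fixes A :: "real mat"
  assumes A: "A \<in> carrier_mat n n" and sym: "A\<^sup>T = A"
  obtains es where "char_poly A = (\<Prod>e\<leftarrow>es. [:- e, 1:])"
proof -
  define B where "B = map_mat complex_of_real A"
  have B: "B \<in> carrier_mat n n"
    using A by (simp add: B_def)
  obtain cs where cs: "char_poly B = (\<Prod>c\<leftarrow>cs. [:- c, 1:])"
    using char_poly_factorized[OF B] by auto
  have real: "c = of_real (Re c)" if "c \<in> set cs" for c
  proof -
    have "poly (char_poly B) c = 0"
      using that by (auto simp: cs poly_prod_list prod_list_zero_iff)
    then have "eigenvalue B c"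
      using eigenvalue_root_char_poly[OF B] by simp
    then show ?thesis
      using complex_eigenvalue_of_real_symmetric[OF A sym] by (simp add: B_def)
  qed
  interpret map_poly_inj_comm_ring_hom complex_of_real ..
  have "map_poly complex_of_real (char_poly A) = char_poly B"
    unfolding B_def by (rule of_real_hom.char_poly_hom[OF A, symmetric])
  also have "\<dots> = (\<Prod>c\<leftarrow>cs. map_poly complex_of_real [:- Re c, 1:])"
    unfolding cs using real by (intro arg_cong[where f = prod_list] map_cong) auto
  also have "\<dots> = map_poly complex_of_real (\<Prod>e\<leftarrow>map Re cs. [:- e, 1:])"
    by (simp add: hom_prod_list o_def)
  finally have "char_poly A = (\<Prod>e\<leftarrow>map Re cs. [:- e, 1:])"
    by simp
  then show ?thesis
    by (rule that)
qed

text \<open>Gram-Schmidt keeps the first vector of its input, so a basis starting with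
  \<open>v\<close> yields an orthogonal basis starting with \<open>v\<close>. Dividing by the
  lengths makes it orthonormal.\<close>

lemma orthogonal_completion:
  fixes v :: "real vec"
  assumes v: "v \<in> carrier_vec n" and v0: "v \<noteq> 0\<^sub>v n"
  obtains W where "W \<in> carrier_mat n n" "W\<^sup>T * W = 1\<^sub>m n" "\<exists>k. col W 0 = k \<cdot>\<^sub>v v"
proof -
  interpret cof_vec_space n "TYPE(real)" .
  define b where "b = basis_completion v"
  note bc = basis_completion[OF v v0, folded b_def]
  define ws where "ws = gram_schmidt n b"
  have ws: "set ws \<subseteq> carrier_vec n" "corthogonal ws" "length ws = n"
    using gram_schmidt_result[OF bc(2,4,5) ws_def] bc(6) by auto
  have n: "n \<noteq> 0"
    using v v0 by (metis carrier_vecD vec_of_dim_0)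
  obtain vs where bv: "b = v # vs"
    using bc(6,7) n by (cases b) auto
  have "hd ws = v"
    using gram_schmidt_hd[OF v, of vs] by (simp add: ws_def bv)
  then have ws0: "ws ! 0 = v"
    using ws(3) n by (cases ws) auto
  define u where "u i = (1 / sqrt (ws ! i \<bullet> ws ! i)) \<cdot>\<^sub>v (ws ! i)" for i
  have wsi: "ws ! i \<in> carrier_vec n" if "i < n" for i
    using ws that by auto
  define W where "W = mat_of_cols n (map u [0..<n])"
  have W: "W \<in> carrier_mat n n"
    unfolding W_def by (metis diff_zero length_map length_upt mat_of_cols_carrier(1))
  have col: "col W i = u i" if "i < n" for i
    using that wsi[OF that] unfolding W_def by (subst col_mat_of_cols) (auto simp: u_def)
  have orth: "ws ! i \<bullet> ws ! j = 0 \<longleftrightarrow> i \<noteq> j" if "i < n"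
      "j < n" for i j
    using corthogonalD[OF ws(2), of i j] that ws(3) by simp
  have uu: "u i \<bullet> u j = (if i = j then 1 else 0)" if ij: "i < n" "j < n" for i j
  proof (cases "i = j")
    case True
    have "ws ! i \<bullet> ws ! i \<noteq> 0"
      using orth[OF ij(1) ij(1)] by simp
    moreover have "ws ! i \<bullet> ws ! i \<ge> 0"
      by (simp add: scalar_prod_def sum_nonneg)
    ultimately show ?thesis
      using True wsi[OF ij(1)] by (simp add: u_def)
  next
    case False
    then show ?thesis
      using orth[OF ij] wsi[OF ij(1)] wsi[OF ij(2)] by (simp add: u_def)
  qed
  have "W\<^sup>T * W = 1\<^sub>m n"
    using W by (intro eq_matI) (auto simp: col uu)
  moreover have "col W 0 = (1 / sqrt (v \<bullet> v)) \<cdot>\<^sub>v v"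
    using n by (simp add: col u_def ws0)
  ultimately show ?thesis
    using that W by blast
qed

definition diag_of_list :: "real list \<Rightarrow> real mat" where
  "diag_of_list es = mat (length es) (length es) (\<lambda>(i, j). if i = j then es ! i else 0)"

lemma diag_of_list_carrier [simp]: "diag_of_list es \<in> carrier_mat (length es) (length es)"
  by (simp add: diag_of_list_def)

lemma diag_of_list_Cons:
  "diag_of_list (e # es) = four_block_mat (mat 1 1 (\<lambda>_. e)) (0\<^sub>m 1 (length es))
     (0\<^sub>m (length es) 1) (diag_of_list es)"
  by (rule eq_matI) (auto simp: diag_of_list_def nth_Cons')

text \<open>The list \<open>es\<close> is given in advance so that the diagonal follows any
  prescribed order of the eigenvalues; the decreasing order is used below. The induction is
  deflation: an eigenvector for the head of the list is split off, and the remaining block has the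
  product over the tail as its characteristic polynomial.\<close>

theorem real_symmetric_orthogonally_diagonalizable:
  fixes A :: "real mat"
  assumes "A \<in> carrier_mat n n" "A\<^sup>T = A"
      "char_poly A = (\<Prod>e\<leftarrow>es. [:- e, 1:])"
  shows "length es = n \<and>
    (\<exists>P \<in> carrier_mat n n. P\<^sup>T * P = 1\<^sub>m n \<and> P\<^sup>T * A * P = diag_of_list es)"
  using assms
proof (induction es arbitrary: n A)
  case Nil
  then have "n = 0"
    using degree_monic_char_poly[of A n] by simp
  with Nil show ?case
    by (auto intro!: bexI[of _ "1\<^sub>m 0"] eq_matI simp: diag_of_list_def)
next
  case (Cons e es)
  note A = Cons.prems(1) and sym = Cons.prems(2)
  have "poly (char_poly A) e = 0"
    by (simp add: Cons.prems(3))
  then have "eigenvalue A e"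
    using eigenvalue_root_char_poly[OF A] by simp
  then obtain v where v: "v \<in> carrier_vec n" and v0: "v \<noteq> 0\<^sub>v n" and Av: "A *\<^sub>v v = e \<cdot>\<^sub>v v"
    using A unfolding eigenvalue_def eigenvector_def by auto
  obtain m where n: "n = Suc m"
    using v v0 by (metis carrier_vecD vec_of_dim_0 not0_implies_Suc)
  obtain W k where W: "W \<in> carrier_mat n n" and WW: "W\<^sup>T * W = 1\<^sub>m n" and W0: "col W 0 = k \<cdot>\<^sub>v v"
    using orthogonal_completion[OF v v0] by blast
  define A' where "A' = W\<^sup>T * A * W"
  have A': "A' \<in> carrier_mat n n"
    using A W by (simp add: A'_def)
  have symA': "A'\<^sup>T = A'"
    using A W sym by (simp add: A'_def transpose_mult[of _ n n _ n] assoc_mult_mat[of _ n n _ n _ n])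
  have WW': "W * W\<^sup>T = 1\<^sub>m n"
    using mat_mult_left_right_inverse[OF _ W WW] W by simp
  have sim: "similar_mat A' A"
    unfolding similar_mat_def
    by (rule exI[of _ "W\<^sup>T"], rule exI[of _ W], rule similar_mat_witI[of _ _ n])
       (use A W A' WW WW' in \<open>auto simp: A'_def\<close>)
  have AW0: "A *\<^sub>v col W 0 = e \<cdot>\<^sub>v col W 0"
    using A v by (simp add: W0 mult_mat_vec Av smult_smult_assoc mult.commute)
  \<comment> \<open>The first column of \<open>W\<close> is a multiple of the eigenvector, so
    \<open>A'\<close> sends the first unit vector to \<open>e\<close> times itself. Symmetry then
    clears the first row as well.\<close>
  have col0: "A' $$ (i, 0) = (if i = 0 then e else 0)" if i: "i < n" for i
  proof -
    have "A' $$ (i, 0) = row W\<^sup>T i \<bullet> (A *\<^sub>v col W 0)"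
      using A W i n
      by (simp add: A'_def assoc_mult_mat[of _ n n _ n _ n] col_mult2[of _ n n _ n]
          mult_mat_vec_def)
    also have "\<dots> = e * (W\<^sup>T * W) $$ (i, 0)"
      using W i n by (simp add: AW0)
    finally show ?thesis
      using i n by (simp add: WW)
  qed
  have row0: "A' $$ (0, i) = (if i = 0 then e else 0)" if i: "i < n" for i
    using col0[OF i] A' i n arg_cong[OF symA', of "\<lambda>M. M $$ (0, i)"] by simp
  define A3 where "A3 = mat m m (\<lambda>(i, j). A' $$ (Suc i, Suc j))"
  have A3: "A3 \<in> carrier_mat m m"
    by (simp add: A3_def)
  have block: "A' = four_block_mat (mat 1 1 (\<lambda>_. e)) (0\<^sub>m 1 m) (0\<^sub>m m 1) A3"
    by (rule eq_matI) (use A' n col0 row0 in \<open>auto simp: A3_def\<close>)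
  have "A3\<^sup>T = A3"
  proof (rule eq_matI)
    fix i j assume "i < dim_row A3" "j < dim_col A3"
    then show "A3\<^sup>T $$ (i, j) = A3 $$ (i, j)"
      using A' n arg_cong[OF symA', of "\<lambda>M. M $$ (Suc i, Suc j)"] by (simp add: A3_def)
  qed (simp_all add: A3_def)
  moreover have "char_poly A3 = (\<Prod>e\<leftarrow>es. [:- e, 1:])"
  proof -
    have "[:- e, 1:] * (\<Prod>e\<leftarrow>es. [:- e, 1:]) = char_poly A'"
      using char_poly_similar[OF sim] Cons.prems(3) by simp
    also have "\<dots> = char_poly (mat 1 1 (\<lambda>_. e)) * char_poly A3"
      unfolding block by (rule char_poly_four_block_zeros_col) (use A3 in auto)
    also have "char_poly (mat 1 1 (\<lambda>_. e)) = [:- e, 1:]"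
      by (simp add: char_poly_defs det_def sign_def)
    finally show ?thesis
      by (metis mult_cancel_left pCons_eq_0_iff zero_neq_one)
  qed
  ultimately obtain P where len: "length es = m" and P: "P \<in> carrier_mat m m"
    and PP: "P\<^sup>T * P = 1\<^sub>m m" and PAP: "P\<^sup>T * A3 * P = diag_of_list es"
    using Cons.IH[OF A3] by blast
  define R where "R = four_block_mat (1\<^sub>m 1) (0\<^sub>m 1 m) (0\<^sub>m m 1) P"
  have R: "R \<in> carrier_mat n n"
    using P n by (auto simp: R_def)
  have RT: "R\<^sup>T = four_block_mat (1\<^sub>m 1) (0\<^sub>m 1 m) (0\<^sub>m m 1) P\<^sup>T"
    unfolding R_def by (subst transpose_four_block_mat[of _ 1 1 _ m _ m]) (use P in auto)
  have RR: "R\<^sup>T * R = 1\<^sub>m n"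
    unfolding RT unfolding R_def
    by (subst mult_four_block_mat[of _ 1 1 _ m _ m _ _ 1 _ m]) (use P PP n in auto)
  have RAR: "R\<^sup>T * A' * R = diag_of_list (e # es)"
    unfolding RT block unfolding R_def diag_of_list_Cons len
    by (subst mult_four_block_mat[of _ 1 1 _ m _ m _ _ 1 _ m],
        use P A3 in auto, subst mult_four_block_mat[of _ 1 1 _ m _ m _ _ 1 _ m],
        use P A3 PAP len diag_of_list_carrier[of es] in auto)
  have "(W * R)\<^sup>T * (W * R) = R\<^sup>T * (W\<^sup>T * W) * R"
    using W R by (simp add: transpose_mult[of _ n n _ n] assoc_mult_mat[of _ n n _ n _ n])
  also have "\<dots> = 1\<^sub>m n"
    using R by (simp add: WW RR)
  finally have "(W * R)\<^sup>T * (W * R) = 1\<^sub>m n" .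
  moreover have "(W * R)\<^sup>T * A * (W * R) = diag_of_list (e # es)"
    using W R A RAR
    by (simp add: A'_def transpose_mult[of _ n n _ n] assoc_mult_mat[of _ n n _ n _ n])
  ultimately show ?case
    using W R len n by (intro conjI bexI[of _ "W * R"]) auto
qed

section \<open>Forms that are negative definite on a hyperplane\<close>

text \<open>For a symmetric form on a finite set this means that at most one eigenvalue, counted
  with multiplicity, is nonnegative. As soon as some \<open>m v v\<close> is positive, the signature
  is that of Minkowski space: one plus, otherwise minus. The normal \<open>w\<close> may be zero, in
  which case the form is negative definite everywhere.\<close>

definition lorentzian :: "'a set \<Rightarrow> ('a \<Rightarrow> 'a \<Rightarrow> real) \<Rightarrow> bool" where
  "lorentzian V m \<longleftrightarrow>
     (\<exists>w. \<forall>y. (\<exists>v\<in>V. y v \<noteq> 0) \<longrightarrow> (\<Sum>v\<in>V. w v * y v) = 0 \<longrightarrow>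
       (\<Sum>u\<in>V. \<Sum>v\<in>V. m u v * y u * y v) < 0)"

text \<open>The contrapositive suits forms written as minus a sum of squares: a nonnegative value
  forces each square to vanish.\<close>

lemma lorentzianI:
  assumes "\<And>y. (\<Sum>v\<in>V. w v * y v) = 0 \<Longrightarrow> (\<Sum>u\<in>V. \<Sum>v\<in>V. m u v * y u * y v) \<ge> 0 \<Longrightarrow>
    \<forall>v\<in>V. y v = 0"
  shows "lorentzian V m"
  unfolding lorentzian_def
proof (intro exI[of _ w] allI impI)
  fix y
  assume "\<exists>v\<in>V. y v \<noteq> 0" "(\<Sum>v\<in>V. w v * y v) = 0"
  then show "(\<Sum>u\<in>V. \<Sum>v\<in>V. m u v * y u * y v) < 0"
    using assms[of y] by fastforce
qed

lemma quadratic_form_rows: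
  fixes m :: "'a \<Rightarrow> 'a \<Rightarrow> real"
  shows "(\<Sum>u\<in>V. \<Sum>v\<in>V. m u v * y u * y v) = (\<Sum>u\<in>V. (\<Sum>v\<in>V. m u v * y v) * y u)"
  unfolding sum_distrib_right by (intro sum.cong refl) simp

text \<open>Extension by zero along \<open>f\<close> multiplies the form by \<open>k\<close>, and
  \<open>w \<circ> f\<close> is the normal of the pulled back hyperplane. In terms of matrices, the
  property passes to principal submatrices and survives positive scaling.\<close>

lemma lorentzian_embedding:
  assumes fin: "finite V'" and inj: "inj_on f V" and sub: "f ` V \<subseteq> V'" and "k > 0"
    and m: "\<And>u v. u \<in> V \<Longrightarrow> v \<in> V \<Longrightarrow> m' (f u) (f v) = k * m u v"
    and lor: "lorentzian V' m'"
  shows "lorentzian V m"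
proof -
  obtain w where w: "\<And>y. \<exists>v\<in>V'. y v \<noteq> 0 \<Longrightarrow> (\<Sum>v\<in>V'. w v * y v) = 0 \<Longrightarrow>
      (\<Sum>u\<in>V'. \<Sum>v\<in>V'. m' u v * y u * y v) < 0"
    using lor unfolding lorentzian_def by blast
  show ?thesis
    unfolding lorentzian_def
  proof (intro exI[of _ "w \<circ> f"] allI impI)
    fix y :: "'b \<Rightarrow> real"
    assume nz: "\<exists>v\<in>V. y v \<noteq> 0" and orth: "(\<Sum>v\<in>V. (w \<circ> f) v * y v) = 0"
    define y' where "y' x = (if x \<in> f ` V then y (the_inv_into V f x) else 0)" for x
    have y': "y' (f u) = y u" if "u \<in> V" for u
      using that inj by (simp add: y'_def the_inv_into_f_f)
    have sum: "(\<Sum>v\<in>V'. g v * y' v) = (\<Sum>v\<in>V. g (f v) * y v)" for g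
    proof -
      have "(\<Sum>v\<in>V'. g v * y' v) = (\<Sum>v\<in>f ` V. g v * y' v)"
        using fin sub by (intro sum.mono_neutral_right) (auto simp: y'_def)
      then show ?thesis
        using inj by (simp add: sum.reindex y')
    qed
    have "(\<Sum>u\<in>V'. \<Sum>v\<in>V'. m' u v * y' u * y' v) = (\<Sum>u\<in>V'. (\<Sum>v\<in>V'. m' u v * y' v) * y' u)"
      by (rule quadratic_form_rows)
    also have "\<dots> = (\<Sum>u\<in>V. (\<Sum>v\<in>V. m' (f u) (f v) * y v) * y u)"
      by (simp only: sum)
    also have "\<dots> = k * (\<Sum>u\<in>V. \<Sum>v\<in>V. m u v * y u * y v)"
      by (simp add: m sum_distrib_right sum_distrib_left mult_ac)
    finally have eq: "(\<Sum>u\<in>V'. \<Sum>v\<in>V'. m' u v * y' u * y' v)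
        = k * (\<Sum>u\<in>V. \<Sum>v\<in>V. m u v * y u * y v)" .
    have "\<exists>v\<in>V'. y' v \<noteq> 0"
      using nz sub y' by (metis image_subset_iff)
    moreover have "(\<Sum>v\<in>V'. w v * y' v) = 0"
      using orth by (simp add: sum)
    ultimately have "k * (\<Sum>u\<in>V. \<Sum>v\<in>V. m u v * y u * y v) < 0"
      using w unfolding eq[symmetric] by blast
    then show "(\<Sum>u\<in>V. \<Sum>v\<in>V. m u v * y u * y v) < 0"
      using \<open>k > 0\<close> by (simp add: mult_less_0_iff)
  qed
qed

lemma lorentzian_bij:
  assumes fin: "finite V" and bij: "bij_betw f V V'" and "k > 0"
    and m: "\<And>u v. u \<in> V \<Longrightarrow> v \<in> V \<Longrightarrow> m' (f u) (f v) = k * m u v"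
  shows "lorentzian V m \<longleftrightarrow> lorentzian V' m'"
proof
  have fin': "finite V'"
    using fin bij bij_betw_finite by blast
  show "lorentzian V m" if "lorentzian V' m'"
    by (rule lorentzian_embedding[of V' f V k m' m])
       (use that fin' bij m \<open>k > 0\<close> in \<open>auto simp: bij_betw_def\<close>)
  let ?g = "the_inv_into V f"
  have g: "bij_betw ?g V' V"
    using bij by (rule bij_betw_the_inv_into)
  have gm: "m (?g u) (?g v) = (1 / k) * m' u v" if "u \<in> V'" "v \<in> V'" for u v
  proof -
    have "?g u \<in> V" "?g v \<in> V" "f (?g u) = u" "f (?g v) = v"
      using that g bij f_the_inv_into_f_bij_betw[OF bij] by (auto simp: bij_betw_def)
    then show ?thesis
      using m[of "?g u" "?g v"] \<open>k > 0\<close> by simp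
  qed
  show "lorentzian V' m'" if "lorentzian V m"
    by (rule lorentzian_embedding[of V ?g V' "1 / k" m m'])
       (use that fin g gm \<open>k > 0\<close> in \<open>auto simp: bij_betw_def\<close>)
qed

text \<open>The plane spanned by \<open>y\<close> and the unit vector at \<open>v\<close> meets the
  hyperplane in a nonzero vector, where the form is negative. If the inequality failed, the form at
  \<open>a y + b e\<close> would be at least \<open>(a l + b)^2\<close>. The vertex \<open>u\<close>
  witnesses that \<open>y\<close> is not a multiple of the unit vector.\<close>

lemma lorentzian_reverse_cauchy_schwarz:
  fixes y :: "'a \<Rightarrow> real"
  assumes fin: "finite V" and lor: "lorentzian V m"
    and sym: "\<And>u w. u \<in> V \<Longrightarrow> w \<in> V \<Longrightarrow> m u w = m w u"
    and v: "v \<in> V" and mv: "m v v = 1" and u: "u \<in> V" "u \<noteq> v" "y u \<noteq> 0"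
  shows "(\<Sum>u\<in>V. \<Sum>w\<in>V. m u w * y u * y w) < (\<Sum>u\<in>V. m v u * y u)\<^sup>2"
proof (rule ccontr)
  define Q where "Q y = (\<Sum>u\<in>V. \<Sum>w\<in>V. m u w * y u * y w)" for y
  define l where "l = (\<Sum>u\<in>V. m v u * y u)"
  assume "\<not> (\<Sum>u\<in>V. \<Sum>w\<in>V. m u w * y u * y w) < (\<Sum>u\<in>V. m v u * y u)\<^sup>2"
  then have Qy: "Q y \<ge> l\<^sup>2"
    by (simp add: Q_def l_def)
  obtain w where w: "\<And>y. \<exists>v\<in>V. y v \<noteq> 0 \<Longrightarrow> (\<Sum>v\<in>V. w v * y v) = 0 \<Longrightarrow> Q y < 0"
    using lor unfolding lorentzian_def Q_def by blast
  define e where "e x = (if x = v then 1 else 0 :: real)" for x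
  have sum_e: "(\<Sum>x\<in>V. g x * e x) = g v" for g
    using fin v by (simp add: e_def if_distrib sum.delta cong: if_cong)
  have Q_lin: "Q (\<lambda>x. a * y x + b * e x) = a\<^sup>2 * Q y + 2 * a * b * l + b\<^sup>2" for a b
  proof -
    have 1: "(\<Sum>x\<in>V. g x * (a * y x + b * e x)) = a * (\<Sum>x\<in>V. g x * y x) + b * g v" for g
    proof -
      have "(\<Sum>x\<in>V. g x * (a * y x + b * e x)) = a * (\<Sum>x\<in>V. g x * y x) + b * (\<Sum>x\<in>V. g x * e x)"
        by (simp add: sum_distrib_left sum.distrib algebra_simps)
      then show ?thesis
        by (simp add: sum_e)
    qed
    have "Q (\<lambda>x. a * y x + b * e x)
        = (\<Sum>u\<in>V. (\<Sum>w\<in>V. m u w * (a * y w + b * e w)) * (a * y u + b * e u))"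
      unfolding Q_def by (rule quadratic_form_rows)
    also have "\<dots> = a * (\<Sum>u\<in>V. (a * (\<Sum>w\<in>V. m u w * y w) + b * m u v) * y u)
        + b * (a * (\<Sum>w\<in>V. m v w * y w) + b * m v v)"
      unfolding 1 ..
    also have "(\<Sum>u\<in>V. (a * (\<Sum>w\<in>V. m u w * y w) + b * m u v) * y u)
        = a * Q y + b * (\<Sum>u\<in>V. m u v * y u)"
      by (simp add: Q_def sum_distrib_left sum_distrib_right sum.distrib algebra_simps)
    also have "(\<Sum>u\<in>V. m u v * y u) = l"
      unfolding l_def using sym v by (intro sum.cong) auto
    finally show ?thesis
      by (simp add: mv l_def algebra_simps power2_eq_square)
  qed
  define a where "a = w v"
  \<comment> \<open>Otherwise the unit vector at \<open>v\<close> would lie in the hyperplane,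
    although its form value is 1.\<close>
  have a0: "a \<noteq> 0"
  proof
    assume "a = 0"
    then have "(\<Sum>x\<in>V. w x * (0 * y x + 1 * e x)) = 0"
      using sum_e[of w] by (simp add: a_def)
    moreover have "\<exists>x\<in>V. 0 * y x + 1 * e x \<noteq> 0"
      using v by (auto simp: e_def)
    ultimately have "Q (\<lambda>x. 0 * y x + 1 * e x) < 0"
      by (rule w[rotated])
    then show False
      unfolding Q_lin by simp
  qed
  \<comment> \<open>With these coefficients \<open>a y + b e\<close> is orthogonal to
    \<open>w\<close>.\<close>
  define b where "b = - (\<Sum>x\<in>V. w x * y x)"
  have "(\<Sum>x\<in>V. w x * (a * y x + b * e x)) = a * (\<Sum>x\<in>V. w x * y x) + b * (\<Sum>x\<in>V. w x * e x)"
    by (simp add: sum_distrib_left sum.distrib algebra_simps)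
  also have "\<dots> = 0"
    by (simp add: sum_e a_def b_def)
  finally have "(\<Sum>x\<in>V. w x * (a * y x + b * e x)) = 0" .
  moreover have "\<exists>x\<in>V. a * y x + b * e x \<noteq> 0"
    using u a0 by (intro bexI[of _ u]) (auto simp: e_def)
  ultimately have "a\<^sup>2 * Q y + 2 * a * b * l + b\<^sup>2 < 0"
    using w Q_lin by metis
  moreover have "a\<^sup>2 * Q y + 2 * a * b * l + b\<^sup>2 \<ge> a\<^sup>2 * l\<^sup>2 + 2 * a * b * l + b\<^sup>2"
    using Qy by (simp add: mult_left_mono)
  moreover have "a\<^sup>2 * l\<^sup>2 + 2 * a * b * l + b\<^sup>2 = (a * l + b)\<^sup>2"
    by (simp add: power2_eq_square algebra_simps)
  ultimately show False
    using zero_le_power2[of "a * l + b"] by linarith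
qed

text \<open>Sparse vectors are written as lists of vertices with coefficients, so that both sides
  become explicit finite sums for a concrete configuration. Entries for the same vertex add up; the
  head \<open>(u, c)\<close> must not recur, because it is the nonzero entry away from
  \<open>v\<close>.\<close>

lemma lorentzian_certificate:
  fixes xs :: "('a \<times> real) list"
  assumes fin: "finite V" and lor: "lorentzian V m"
    and sym: "\<And>u w. u \<in> V \<Longrightarrow> w \<in> V \<Longrightarrow> m u w = m w u"
    and v: "v \<in> V" and mv: "m v v = 1"
    and xs: "fst ` set ((u, c) # xs) \<subseteq> V"
    and u: "u \<noteq> v" "u \<notin> fst ` set xs" "c \<noteq> 0"
  shows "(\<Sum>(p, a)\<leftarrow>(u, c) # xs. \<Sum>(q, b)\<leftarrow>(u, c) # xs. a * b * m p q)
    < (\<Sum>(p, a)\<leftarrow>(u, c) # xs. a * m v p)\<^sup>2"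
proof -
  define y where "y ys x = (\<Sum>(p, a)\<leftarrow>ys. if p = x then a else 0)" for ys :: "('a \<times> real) list" and x
  have sum: "(\<Sum>x\<in>V. g x * y ys x) = (\<Sum>(p, a)\<leftarrow>ys. a * g p)" if "fst ` set ys \<subseteq> V" for ys g
    using that
  proof (induction ys)
    case (Cons z ys)
    obtain p a where z: "z = (p, a)"
      by fastforce
    have "(\<Sum>x\<in>V. g x * y (z # ys) x)
        = (\<Sum>x\<in>V. (if p = x then g x * a else 0) + g x * y ys x)"
      by (intro sum.cong) (auto simp: y_def z algebra_simps)
    also have "\<dots> = a * g p + (\<Sum>x\<in>V. g x * y ys x)"
      using fin Cons.prems by (simp add: sum.distrib z sum.delta)
    finally show ?case
      using Cons by (simp add: z)
  qed (simp add: y_def)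
  let ?xs = "(u, c) # xs"
  have "(\<Sum>p\<in>V. \<Sum>q\<in>V. m p q * y ?xs p * y ?xs q) = (\<Sum>p\<in>V. (\<Sum>q\<in>V. m p q * y ?xs q) * y ?xs p)"
    by (rule quadratic_form_rows)
  also have "\<dots> = (\<Sum>(p, a)\<leftarrow>?xs. a * (\<Sum>(q, b)\<leftarrow>?xs. b * m p q))"
    by (simp only: sum[OF xs])
  also have "\<dots> = (\<Sum>(p, a)\<leftarrow>?xs. \<Sum>(q, b)\<leftarrow>?xs. a * b * m p q)"
    by (simp add: case_prod_beta' mult.assoc distrib_left flip: sum_list_const_mult)
  finally have Q: "(\<Sum>p\<in>V. \<Sum>q\<in>V. m p q * y ?xs p * y ?xs q)
      = (\<Sum>(p, a)\<leftarrow>?xs. \<Sum>(q, b)\<leftarrow>?xs. a * b * m p q)" .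
  have "y xs u = 0"
    using u(2) unfolding y_def by (induction xs) auto
  then have "y ?xs u \<noteq> 0"
    using u(3) by (simp add: y_def)
  moreover have "u \<in> V"
    using xs by simp
  ultimately have "(\<Sum>p\<in>V. \<Sum>q\<in>V. m p q * y ?xs p * y ?xs q) < (\<Sum>p\<in>V. m v p * y ?xs p)\<^sup>2"
    using lorentzian_reverse_cauchy_schwarz[OF fin lor sym v mv _ u(1)] by blast
  then show ?thesis
    unfolding Q unfolding sum[OF xs] .
qed

section \<open>The second largest eigenvalue and negative definiteness on a hyperplane\<close>

lemma proots_prod_list_linear: "proots (\<Prod>e\<leftarrow>es. [:- e, 1:]) = mset es"
  for es :: "real list"
proof (induction es)
  case (Cons e es)
  have "(\<Prod>e\<leftarrow>es. [:- e, 1:]) \<noteq> 0"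
    by (auto simp: prod_list_zero_iff)
  then show ?case
    using Cons by (simp add: proots_mult del: mult_pCons_left)
qed simp

lemma eigenvalues_desc_real_symmetric:
  fixes A :: "real mat"
  assumes A: "A \<in> carrier_mat n n" and sym: "A\<^sup>T = A"
  shows "char_poly A = (\<Prod>e\<leftarrow>eigenvalues_desc A. [:- e, 1:])"
    and "sorted_wrt (\<ge>) (eigenvalues_desc A)"
proof -
  obtain es where es: "char_poly A = (\<Prod>e\<leftarrow>es. [:- e, 1:])"
    using char_poly_real_symmetric_splits[OF A sym] .
  have "mset (eigenvalues_desc A) = mset es"
    by (simp add: eigenvalues_desc_def es proots_prod_list_linear)
  then show "char_poly A = (\<Prod>e\<leftarrow>eigenvalues_desc A. [:- e, 1:])"
    unfolding es by (metis mset_map prod_mset_prod_list)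
  show "sorted_wrt (\<ge>) (eigenvalues_desc A)"
    by (simp add: eigenvalues_desc_def sorted_wrt_rev)
qed

text \<open>This is the Courant-Fischer principle. In an orthonormal eigenbasis the form has the
  diagonal coefficients \<open>es ! k - c\<close>. If only the first can be nonnegative, the
  complement of the first eigenvector serves as hyperplane; if the first two are nonnegative, every
  hyperplane contains a nonzero combination of the first two eigenvectors.\<close>

theorem second_eigenvalue_less_iff:
  fixes A :: "real mat"
  assumes A: "A \<in> carrier_mat n n" and sym: "A\<^sup>T = A" and n: "n \<ge> 2"
  shows "eigenvalues_desc A ! 1 < c \<longleftrightarrow>
    lorentzian {..<n} (\<lambda>i j. A $$ (i, j) - (if i = j then c else 0))"
proof -
  define es where "es = eigenvalues_desc A"
  have sorted: "sorted_wrt (\<ge>) es" and cp: "char_poly A = (\<Prod>e\<leftarrow>es. [:- e, 1:])"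
    using eigenvalues_desc_real_symmetric[OF A sym] by (simp_all add: es_def)
  obtain P where len: "length es = n" and P: "P \<in> carrier_mat n n" and PP: "P\<^sup>T * P = 1\<^sub>m n"
    and PAP: "P\<^sup>T * A * P = diag_of_list es"
    using real_symmetric_orthogonally_diagonalizable[OF A sym cp] by blast
  have PP': "P * P\<^sup>T = 1\<^sub>m n"
    using mat_mult_left_right_inverse[OF _ P PP] P by simp
  define Q where "Q y = (\<Sum>i<n. \<Sum>j<n. (A $$ (i, j) - (if i = j then c else 0)) * y i * y j)" for y
  have Q: "Q (\<lambda>i. (P *\<^sub>v z) $ i) = (\<Sum>k<n. (es ! k - c) * (z $ k)\<^sup>2)" if z: "z \<in> carrier_vec n" for z
  proof -
    let ?x = "P *\<^sub>v z"
    have x: "?x \<in> carrier_vec n"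
      using P z by simp
    have adj: "u \<bullet> (M *\<^sub>v ?x) = z \<bullet> (P\<^sup>T *\<^sub>v (M *\<^sub>v ?x))"
      if "u = ?x" "M \<in> carrier_mat n n" for u M
      using transpose_vec_mult_scalar[OF P z, of "M *\<^sub>v ?x"] comm_scalar_prod[of _ n] P x that z
      by (metis (no_types, opaque_lifting) mult_mat_vec_carrier transpose_carrier_mat)
    have "Q (\<lambda>i. ?x $ i) = (\<Sum>i<n. (A *\<^sub>v ?x) $ i * ?x $ i - c * (?x $ i * ?x $ i))"
      unfolding Q_def
    proof (intro sum.cong refl)
      fix i assume i: "i \<in> {..<n}"
      have "(\<Sum>j<n. (A $$ (i, j) - (if i = j then c else 0)) * ?x $ i * ?x $ j)
          = (\<Sum>j<n. A $$ (i, j) * ?x $ j * ?x $ i - (if i = j then c * (?x $ i * ?x $ i) else 0))"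
        by (intro sum.cong) (auto simp: algebra_simps)
      also have "\<dots> = (\<Sum>j<n. A $$ (i, j) * ?x $ j) * ?x $ i - c * (?x $ i * ?x $ i)"
        using i by (simp only: sum_subtractf sum_distrib_right) simp
      also have "(\<Sum>j<n. A $$ (i, j) * ?x $ j) = (A *\<^sub>v ?x) $ i"
        using i A P carrier_vecD[OF x]
        by (simp add: scalar_prod_def atLeast0LessThan)
      finally show "(\<Sum>j<n. (A $$ (i, j) - (if i = j then c else 0)) * ?x $ i * ?x $ j)
          = (A *\<^sub>v ?x) $ i * ?x $ i - c * (?x $ i * ?x $ i)" .
    qed
    also have "\<dots> = (A *\<^sub>v ?x) \<bullet> ?x - c * (?x \<bullet> ?x)"
      using x unfolding scalar_prod_def
      by (simp only: sum_subtractf sum_distrib_left[symmetric] carrier_vecD[OF x] atLeast0LessThan)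
    also have "(A *\<^sub>v ?x) \<bullet> ?x = z \<bullet> (P\<^sup>T *\<^sub>v (A *\<^sub>v ?x))"
      using adj[OF refl A] comm_scalar_prod[of "A *\<^sub>v ?x" n ?x] A x by simp
    also have "P\<^sup>T *\<^sub>v (A *\<^sub>v ?x) = diag_of_list es *\<^sub>v z"
      using A P z
      by (simp add: assoc_mult_mat_vec[of _ n n _ n] assoc_mult_mat[of _ n n _ n _ n] flip: PAP)
    also have "?x \<bullet> ?x = z \<bullet> (P\<^sup>T *\<^sub>v ?x)"
      using adj[OF refl one_carrier_mat] x by simp
    also have "P\<^sup>T *\<^sub>v ?x = z"
      using P z PP by (metis assoc_mult_mat_vec one_mult_mat_vec transpose_carrier_mat)
    also have "diag_of_list es *\<^sub>v z = vec n (\<lambda>k. es ! k * z $ k)"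
    proof (rule eq_vecI)
      fix k assume "k < dim_vec (vec n (\<lambda>k. es ! k * z $ k))"
      then have k: "k < n"
        by simp
      have "(diag_of_list es *\<^sub>v z) $ k = (\<Sum>j<n. (if k = j then es ! k else 0) * z $ j)"
        using k z len by (simp add: diag_of_list_def scalar_prod_def atLeast0LessThan)
      also have "\<dots> = (\<Sum>j<n. if k = j then es ! k * z $ k else 0)"
        by (intro sum.cong) auto
      finally show "(diag_of_list es *\<^sub>v z) $ k = vec n (\<lambda>k. es ! k * z $ k) $ k"
        using k by simp
    qed (simp add: diag_of_list_def len)
    finally show ?thesis
      using z by (simp add: scalar_prod_def left_diff_distrib sum_subtractf sum_distrib_left
          power2_eq_square atLeast0LessThan right_diff_distrib mult_ac)
  qed
  have L: "lorentzian {..<n} (\<lambda>i j. A $$ (i, j) - (if i = j then c else 0)) \<longleftrightarrow>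
      (\<exists>w. \<forall>y. (\<exists>i<n. y i \<noteq> 0) \<longrightarrow> (\<Sum>i<n. w i * y i) = 0 \<longrightarrow> Q y < 0)"
    by (simp add: lorentzian_def Q_def Bex_def)
  have "eigenvalues_desc A ! 1 < c \<longleftrightarrow> es ! 1 < c"
    by (simp add: es_def)
  also have "\<dots> \<longleftrightarrow> (\<exists>w. \<forall>y. (\<exists>i<n. y i \<noteq> 0) \<longrightarrow> (\<Sum>i<n. w i * y i) = 0 \<longrightarrow> Q y < 0)"
  proof
    assume less: "es ! 1 < c"
    have small: "es ! k < c" if "0 < k" "k < n" for k
    proof (cases "k = 1")
      case False
      then have "es ! k \<le> es ! 1"
        using sorted that len by (simp add: sorted_wrt_iff_nth_less)
      then show ?thesis
        using less by simp
    qed (use less in simp)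
    show "\<exists>w. \<forall>y. (\<exists>i<n. y i \<noteq> 0) \<longrightarrow> (\<Sum>i<n. w i * y i) = 0 \<longrightarrow> Q y < 0"
    \<comment> \<open>Column 0 of \<open>P\<close> is an eigenvector of the largest eigenvalue.
      Orthogonality to it says that the coordinate \<open>z $ 0\<close> vanishes.\<close>
    proof (intro exI[of _ "\<lambda>i. P $$ (i, 0)"] allI impI)
      fix y :: "nat \<Rightarrow> real"
      assume nz: "\<exists>i<n. y i \<noteq> 0" and orth: "(\<Sum>i<n. P $$ (i, 0) * y i) = 0"
      define z where "z = P\<^sup>T *\<^sub>v vec n y"
      have z: "z \<in> carrier_vec n"
        using P by (simp add: z_def)
      have Pz: "P *\<^sub>v z = vec n y"
        unfolding z_def using P PP' by (metis assoc_mult_mat_vec one_mult_mat_vec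
            transpose_carrier_mat vec_carrier)
      have z0: "z $ 0 = 0"
        using P orth n by (simp add: z_def scalar_prod_def atLeast0LessThan mult.commute)
      have "z \<noteq> 0\<^sub>v n"
      proof
        assume "z = 0\<^sub>v n"
        moreover have "P *\<^sub>v 0\<^sub>v n = 0\<^sub>v n"
          using P by (intro eq_vecI) auto
        ultimately have "vec n y = 0\<^sub>v n"
          using Pz by simp
        then show False
          using nz by (metis index_vec index_zero_vec(1))
      qed
      then obtain k where k: "k < n" "z $ k \<noteq> 0"
        using z by (metis carrier_vecD eq_vecI index_zero_vec)
      have "Q y = Q (\<lambda>i. (P *\<^sub>v z) $ i)"
        unfolding Q_def by (intro sum.cong) (auto simp: Pz)
      also have "\<dots> = (\<Sum>k<n. (es ! k - c) * (z $ k)\<^sup>2)"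
        by (rule Q[OF z])
      also have "\<dots> < 0"
      proof -
        have "(\<Sum>k<n. (c - es ! k) * (z $ k)\<^sup>2) > 0"
        proof (rule sum_pos2[of _ k])
          show "0 < (c - es ! k) * (z $ k)\<^sup>2"
            using k z0 small[of k] by (cases "k = 0") auto
          show "0 \<le> (c - es ! i) * (z $ i)\<^sup>2" if "i \<in> {..<n}" for i
            using that z0 small[of i] by (cases "i = 0") auto
        qed (use k in auto)
        then show ?thesis
          by (simp add: left_diff_distrib sum_subtractf)
      qed
      finally show "Q y < 0" .
    qed
  next
    assume "\<exists>w. \<forall>y. (\<exists>i<n. y i \<noteq> 0) \<longrightarrow> (\<Sum>i<n. w i * y i) = 0 \<longrightarrow> Q y < 0"
    then obtain w where w: "\<And>y. \<exists>i<n. y i \<noteq> 0 \<Longrightarrow> (\<Sum>i<n. w i * y i) = 0 \<Longrightarrow> Q y < 0"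
      by blast
    show "es ! 1 < c"
    proof (rule ccontr)
      assume ge: "\<not> es ! 1 < c"
      moreover have "es ! 0 \<ge> es ! 1"
        using sorted n len by (simp add: sorted_wrt_iff_nth_less)
      ultimately have ge': "es ! 0 \<ge> c" "es ! 1 \<ge> c"
        by auto
      define s where "s k = (\<Sum>i<n. w i * P $$ (i, k))" for k
      \<comment> \<open>The numbers \<open>s 0\<close> and \<open>s 1\<close> pair \<open>w\<close>
        with the first two eigenvectors. A nontrivial relation between them puts a nonzero
        combination of these eigenvectors into the hyperplane.\<close>
      obtain a b where ab: "a * s 0 + b * s 1 = 0" "a \<noteq> 0 \<or> b \<noteq> 0"
      proof (cases "s 0 = 0")
        case True
        then show ?thesis
          using that[of 1 0] by simp
      next
        case False
        then show ?thesis
          using that[of "- s 1" "s 0"] by simp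
      qed
      define z where "z = vec n (\<lambda>k. if k = 0 then a else if k = 1 then b else 0)"
      have z: "z \<in> carrier_vec n"
        by (simp add: z_def)
      have two: "(\<Sum>k<n. g k * z $ k) = g 0 * a + g 1 * b" for g :: "nat \<Rightarrow> real"
      proof -
        have "(\<Sum>k<n. g k * z $ k) = (\<Sum>k\<in>{0, 1}. g k * z $ k)"
          using n by (intro sum.mono_neutral_right) (auto simp: z_def)
        then show ?thesis
          using n by (simp add: z_def)
      qed
      define y where "y i = (P *\<^sub>v z) $ i" for i
      have "\<exists>i<n. y i \<noteq> 0"
      proof (rule ccontr)
        assume "\<not> ?thesis"
        then have "P *\<^sub>v z = 0\<^sub>v n"
          using P by (intro eq_vecI) (auto simp: y_def)
        then have "P\<^sup>T *\<^sub>v (P *\<^sub>v z) = 0\<^sub>v n"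
          using P by (auto simp: scalar_prod_def)
        then have "z = 0\<^sub>v n"
          using P z PP by (metis assoc_mult_mat_vec one_mult_mat_vec transpose_carrier_mat)
        then have "z $ 0 = 0" "z $ 1 = 0"
          using n by auto
        then show False
          using ab(2) n by (simp add: z_def)
      qed
      moreover have "(\<Sum>i<n. w i * y i) = 0"
      proof -
        have y: "y i = P $$ (i, 0) * a + P $$ (i, 1) * b" if "i < n" for i
          using that P z two[of "\<lambda>k. P $$ (i, k)"]
          by (simp add: y_def scalar_prod_def atLeast0LessThan)
        have "(\<Sum>i<n. w i * y i) = a * s 0 + b * s 1"
          by (simp add: y s_def sum_distrib_left sum.distrib algebra_simps)
        then show ?thesis
          using ab(1) by simp
      qed
      ultimately have "Q y < 0"
        by (rule w)
      moreover have "Q y = (es ! 0 - c) * a * a + (es ! 1 - c) * b * b"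
        using Q[OF z] two[of "\<lambda>k. (es ! k - c) * z $ k"] n
        by (simp add: y_def[abs_def] power2_eq_square mult.assoc z_def)
      moreover have "(es ! 0 - c) * a * a \<ge> 0" "(es ! 1 - c) * b * b \<ge> 0"
        using ge' by (simp_all add: mult.assoc)
      ultimately show False
        by linarith
    qed
  qed
  finally show ?thesis
    unfolding L .
qed

section \<open>Distances and isomorphisms\<close>

text \<open>Agrees with the distance in graphs of diameter at most 3; larger distances are cut to 3.\<close>

definition near_dist :: "'a pair_pre_digraph \<Rightarrow> 'a \<Rightarrow> 'a \<Rightarrow> real" where
  "near_dist G u v =
     (if u = v then 0 else if (u, v) \<in> parcs G then 1
      else if \<exists>w. (u, w) \<in> parcs G \<and> (w, v) \<in> parcs G then 2 else 3)"

definition dist_form :: "'a pair_pre_digraph \<Rightarrow> 'a \<Rightarrow> 'a \<Rightarrow> real" where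
  "dist_form G u v = 2 * near_dist G u v + (if u = v then 1 else 0)"

text \<open>A digraph isomorphism has a separate map on arcs. Since arcs on both sides are pairs
  with the projections as end points, that map is the vertex map applied to both components.\<close>

lemma graph_isoE:
  assumes "G \<simeq>\<^sub>G H"
  obtains f where "bij_betw f (pverts G) (pverts H)"
    "\<And>u v. u \<in> pverts G \<Longrightarrow> v \<in> pverts G \<Longrightarrow> (f u, f v) \<in> parcs H \<longleftrightarrow> (u, v) \<in> parcs G"
proof -
  obtain h where h: "pre_digraph.digraph_isomorphism (with_proj G) h"
    and H: "with_proj H = app_iso h (with_proj G)"
    using assms unfolding digraph_iso_def by blast
  let ?f = "iso_verts h"
  have inj: "inj_on ?f (pverts G)" and wf: "wf_digraph (with_proj G)"
    using h by (auto simp: pre_digraph.digraph_isomorphism_def)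
  have V: "pverts H = ?f ` pverts G" and E: "parcs H = iso_arcs h ` parcs G"
    and t: "iso_tail h = fst" and hd: "iso_head h = snd"
    using H by (auto simp: app_iso_def with_proj_def)
  have arc: "iso_arcs h (u, v) = (?f u, ?f v)" if "(u, v) \<in> parcs G" for u v
    using h that t hd
    by (auto simp: pre_digraph.digraph_isomorphism_def prod_eq_iff)
  have "(?f u, ?f v) \<in> parcs H \<longleftrightarrow> (u, v) \<in> parcs G" if uv: "u \<in> pverts G" "v \<in> pverts G" for u v
  proof
    assume "(?f u, ?f v) \<in> parcs H"
    then obtain a b where ab: "(a, b) \<in> parcs G" "(?f u, ?f v) = iso_arcs h (a, b)"
      unfolding E by auto
    then have "a \<in> pverts G" "b \<in> pverts G"
      using wf_digraph.tail_in_verts[OF wf, of "(a, b)"] wf_digraph.head_in_verts[OF wf, of "(a, b)"]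
      by auto
    then have "u = a" "v = b"
      using ab arc inj uv by (auto simp: inj_on_eq_iff)
    then show "(u, v) \<in> parcs G"
      using ab by simp
  next
    assume "(u, v) \<in> parcs G"
    then show "(?f u, ?f v) \<in> parcs H"
      unfolding E using arc by (metis imageI)
  qed
  then show ?thesis
    using that[of ?f] inj V by (simp add: bij_betw_def)
qed

lemma graph_isoI:
  assumes wf: "pair_wf_digraph G" and bij: "bij_betw f (pverts G) (pverts H)"
    and sub: "parcs H \<subseteq> pverts H \<times> pverts H"
    and arcs: "\<And>u v. u \<in> pverts G \<Longrightarrow> v \<in> pverts G \<Longrightarrow> (f u, f v) \<in> parcs H \<longleftrightarrow> (u, v) \<in> parcs G"
  shows "G \<simeq>\<^sub>G H"
proof -
  interpret pair_wf_digraph G by fact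
  define h where "h = \<lparr>iso_verts = f, iso_arcs = map_prod f f, iso_head = snd, iso_tail = fst\<rparr>"
  have inj: "inj_on f (pverts G)"
    using bij by (simp add: bij_betw_def)
  have "inj_on (map_prod f f) (parcs G)"
    using map_prod_inj_on[OF inj inj] by (rule inj_on_subset) (auto dest: wellformed')
  then have "digraph_isomorphism h"
    using inj wf_digraph_axioms by (auto simp: digraph_isomorphism_def h_def)
  moreover have "parcs H = map_prod f f ` parcs G"
  proof (rule equalityI; rule subsetI)
    fix e assume e: "e \<in> parcs H"
    then have "e \<in> f ` pverts G \<times> f ` pverts G"
      using sub bij by (auto simp: bij_betw_def)
    then obtain u v where uv: "e = (f u, f v)" "u \<in> pverts G" "v \<in> pverts G"
      by auto
    then show "e \<in> map_prod f f ` parcs G"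
      using e arcs by (intro image_eqI[of _ _ "(u, v)"]) auto
  next
    fix e assume "e \<in> map_prod f f ` parcs G"
    then obtain u v where "e = (f u, f v)" "(u, v) \<in> parcs G"
      by auto
    then show "e \<in> parcs H"
      using arcs wellformed' by metis
  qed
  then have "with_proj H = app_iso h (with_proj G)"
    using bij by (simp add: app_iso_def h_def with_proj_def bij_betw_def)
  ultimately show ?thesis
    unfolding digraph_iso_def by blast
qed

text \<open>The middle vertex in \<open>near_dist\<close> ranges over the whole type; the inclusion
  assumed for the arcs of \<open>H\<close> confines it to the image of \<open>f\<close>.\<close>

lemma dist_form_iso:
  assumes G: "pair_wf_digraph G" and H: "parcs H \<subseteq> pverts H \<times> pverts H"
    and bij: "bij_betw f (pverts G) (pverts H)"
    and arcs: "\<And>u v. u \<in> pverts G \<Longrightarrow> v \<in> pverts G \<Longrightarrow> (f u, f v) \<in> parcs H \<longleftrightarrow> (u, v) \<in> parcs G"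
    and uv: "u \<in> pverts G" "v \<in> pverts G"
  shows "dist_form H (f u) (f v) = dist_form G u v"
proof -
  interpret pair_wf_digraph G by fact
  have eq: "f u = f v \<longleftrightarrow> u = v"
    using bij uv by (auto simp: bij_betw_def dest: inj_onD)
  have "(\<exists>w. (f u, w) \<in> parcs H \<and> (w, f v) \<in> parcs H)
      \<longleftrightarrow> (\<exists>w \<in> f ` pverts G. (f u, w) \<in> parcs H \<and> (w, f v) \<in> parcs H)"
    using H bij by (auto simp: bij_betw_def)
  also have "\<dots> \<longleftrightarrow> (\<exists>w. (u, w) \<in> parcs G \<and> (w, v) \<in> parcs G)"
    using arcs uv by (auto dest: wellformed')
  finally show ?thesis
    using arcs[OF uv] by (simp add: dist_form_def near_dist_def eq)
qed

lemma lorentzian_iso: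
  assumes fin: "finite (pverts G)" and "pair_wf_digraph G" and "parcs H \<subseteq> pverts H \<times> pverts H"
    and iso: "G \<simeq>\<^sub>G H"
  shows "lorentzian (pverts G) (dist_form G) \<longleftrightarrow> lorentzian (pverts H) (dist_form H)"
proof -
  obtain f where f: "bij_betw f (pverts G) (pverts H)"
    "\<And>u v. u \<in> pverts G \<Longrightarrow> v \<in> pverts G \<Longrightarrow> (f u, f v) \<in> parcs H \<longleftrightarrow> (u, v) \<in> parcs G"
    using graph_isoE[OF iso] by blast
  show ?thesis
    using dist_form_iso[OF assms(2,3) f] by (intro lorentzian_bij[OF fin f(1), of 1]) auto
qed

section \<open>Distances in a connected split graph\<close>

locale connected_split = pair_graph G for G :: "'a pair_pre_digraph" +
  fixes K I :: "'a set"
  assumes conn: "connected (with_proj G)"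
    and card_ge_2: "card (pverts G) \<ge> 2"
    and clique: "is_clique G K"
    and indep: "is_independent G I"
    and cover: "K \<union> I = pverts G"
    and disj: "K \<inter> I = {}"
begin

definition N :: "'a \<Rightarrow> 'a set" where
  "N i = {c \<in> K. (i, c) \<in> parcs G}"

lemma arc_sym: "(u, v) \<in> parcs G \<longleftrightarrow> (v, u) \<in> parcs G"
  using pair_sym_arcs by (auto simp: symmetric_def elim: symE)

lemma no_loop: "(u, u) \<notin> parcs G"
  using pair_no_loops by force

lemma fin_K: "finite K" and fin_I: "finite I" and fin_V: "finite (pverts G)"
  using pair_finite_verts cover by (metis finite_Un)+

lemma clique_arc: "c \<in> K \<Longrightarrow> d \<in> K \<Longrightarrow> (c, d) \<in> parcs G \<longleftrightarrow> c \<noteq> d"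
  using clique no_loop by (auto simp: is_clique_def)

lemma indep_arc: "i \<in> I \<Longrightarrow> j \<in> I \<Longrightarrow> (i, j) \<notin> parcs G"
  using indep by (auto simp: is_independent_def)

lemma K_sub: "c \<in> K \<Longrightarrow> c \<in> pverts G" and I_sub: "i \<in> I \<Longrightarrow> i \<in> pverts G"
  and K_notin_I: "c \<in> K \<Longrightarrow> c \<notin> I"
  using cover disj by auto

lemma ex_arc:
  assumes "u \<in> pverts G"
  shows "\<exists>v. (u, v) \<in> parcs G"
proof -
  obtain v where v: "v \<in> pverts G" "v \<noteq> u"
    using card_ge_2 assms
    by (metis One_nat_def card_le_Suc0_iff_eq fin_V not_less_eq_eq numeral_2_eq_2)
  have "u \<rightarrow>\<^sup>*\<^bsub>with_proj G\<^esub> v"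
    using symmetric_connected_imp_strongly_connected[OF pair_sym_arcs conn] assms v
    by (auto simp: strongly_connected_def)
  then show ?thesis
  proof (cases rule: converse_reachable_cases)
    case (step w)
    then show ?thesis
      by (auto simp: arcs_ends_def arc_to_ends_def)
  qed (use v in simp)
qed

lemma N_sub: "N i \<subseteq> K"
  by (auto simp: N_def)

lemma N_nonempty: "i \<in> I \<Longrightarrow> N i \<noteq> {}"
  using ex_arc[OF I_sub, of i] indep_arc in_arcsD2 cover by (fastforce simp: N_def)

text \<open>Every vertex lies in \<open>K\<close> or has a neighbour there, and any two vertices of
  \<open>K\<close> are equal or adjacent.\<close>

lemma near_dist_le_3:
  assumes u: "u \<in> pverts G" and v: "v \<in> pverts G"
  shows "u = v \<or> (u, v) \<in> parcs G \<or> (\<exists>w. (u, w) \<in> parcs G \<and> (w, v) \<in> parcs G)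
    \<or> (\<exists>w x. (u, w) \<in> parcs G \<and> (w, x) \<in> parcs G \<and> (x, v) \<in> parcs G)"
proof -
  have *: "\<exists>c\<in>K. x = c \<or> (x, c) \<in> parcs G" if "x \<in> pverts G" for x
    using that N_nonempty[of x] cover by (auto simp: N_def)
  obtain c d where "c \<in> K" "u = c \<or> (u, c) \<in> parcs G" "d \<in> K" "v = d \<or> (v, d) \<in> parcs G"
    using *[OF u] *[OF v] by blast
  then show ?thesis
    using clique_arc[of c d] arc_sym[of d v] by blast
qed

text \<open>A walk with fewer than three arcs forces exactly the equality, arc or common neighbour
  that \<open>near_dist\<close> tests for, which gives the lower bound. The upper bound comes from a
  walk of the required length in each case.\<close>

lemma graph_dist_eq:
  assumes u: "u \<in> pverts G" and v: "v \<in> pverts G"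
  shows "graph_dist G u v = near_dist G u v"
proof -
  have cost: "awalk_cost (\<lambda>_. 1) p = real (length p)" for p :: "('a \<times> 'a) list"
    by (induction p) auto
  have lower: "near_dist G u v \<le> length p" if "awalk u p v" for p
  proof -
    consider "p = []" | e where "p = [e]" | e f where "p = [e, f]" | "length p \<ge> 3"
    proof -
      have "p = [] \<or> (\<exists>e. p = [e]) \<or> (\<exists>e f. p = [e, f]) \<or> length p \<ge> 3"
        by (cases p; cases "tl p"; cases "tl (tl p)") auto
      then show ?thesis
        using that by blast
    qed
    then show ?thesis
    proof cases
      case 1
      then show ?thesis
        using that by (simp add: awalk_Nil_iff near_dist_def)
    next
      case 2
      then show ?thesis
        using that by (cases e) (auto simp: awalk_simps near_dist_def)
    next
      case 3
      then show ?thesis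
        using that by (cases e; cases f) (auto simp: awalk_simps near_dist_def)
    qed (simp add: near_dist_def)
  qed
  have "\<exists>p. awalk u p v \<and> real (length p) = near_dist G u v"
  proof -
    consider "u = v" | "u \<noteq> v" "(u, v) \<in> parcs G"
      | w where "u \<noteq> v" "(u, v) \<notin> parcs G" "(u, w) \<in> parcs G" "(w, v) \<in> parcs G"
      | w x where "near_dist G u v = 3" "(u, w) \<in> parcs G" "(w, x) \<in> parcs G" "(x, v) \<in> parcs G"
      using near_dist_le_3[OF u v] unfolding near_dist_def by metis
    then show ?thesis
    proof cases
      case 1
      then show ?thesis
        using u by (intro exI[of _ "[]"]) (auto simp: awalk_simps near_dist_def)
    next
      case 2
      then show ?thesis
        using v by (intro exI[of _ "[(u, v)]"]) (auto simp: awalk_simps near_dist_def)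
    next
      case 3
      then show ?thesis
        using v by (intro exI[of _ "[(u, w), (w, v)]"]) (auto simp: awalk_simps near_dist_def)
    next
      case 4
      then show ?thesis
        using v by (intro exI[of _ "[(u, w), (w, x), (x, v)]"]) (auto simp: awalk_simps)
    qed
  qed
  then obtain p where p: "awalk u p v" "real (length p) = near_dist G u v"
    by blast
  have "\<mu> (\<lambda>_. 1) u v = ereal (near_dist G u v)"
  proof (rule antisym)
    show "\<mu> (\<lambda>_. 1) u v \<le> ereal (near_dist G u v)"
      using min_cost_le_walk_cost[OF p(1), of "\<lambda>_. 1"] p(2) by (simp add: cost)
    show "ereal (near_dist G u v) \<le> \<mu> (\<lambda>_. 1) u v"
      unfolding \<mu>_def by (rule INF_greatest) (use lower in \<open>auto simp: cost\<close>)
  qed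
  then show ?thesis
    by (simp add: graph_dist_def)
qed

lemma near_dist_sym: "near_dist G u v = near_dist G v u"
  using arc_sym by (auto simp: near_dist_def)

lemma dist_form_sym: "dist_form G u v = dist_form G v u"
  using near_dist_sym[of u v] by (simp add: dist_form_def)

lemma second_dist_eigenvalue_less_iff:
  assumes vs: "distinct vs" "set vs = pverts G"
  shows "second_dist_eigenvalue G vs < - 1 / 2 \<longleftrightarrow> lorentzian (pverts G) (dist_form G)"
proof -
  let ?n = "length vs" and ?D = "distance_matrix G vs"
  have n: "?n \<ge> 2"
    using card_ge_2 distinct_card[OF vs(1)] vs(2) by simp
  have D: "?D $$ (i, j) = near_dist G (vs ! i) (vs ! j)" if "i < ?n" "j < ?n" for i j
    using that vs(2) graph_dist_eq by (simp add: distance_matrix_def) (metis nth_mem)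
  have carrier: "?D \<in> carrier_mat ?n ?n"
    by (simp add: distance_matrix_def)
  have sym: "?D\<^sup>T = ?D"
    by (rule eq_matI) (use carrier D near_dist_sym in auto)
  have bij: "bij_betw ((!) vs) {..<?n} (pverts G)"
    using bij_betw_nth[OF vs(1) refl vs(2)[symmetric]] by simp
  have "second_dist_eigenvalue G vs < - 1 / 2 \<longleftrightarrow>
      lorentzian {..<?n} (\<lambda>i j. ?D $$ (i, j) - (if i = j then - 1 / 2 else 0))"
    unfolding second_dist_eigenvalue_def by (rule second_eigenvalue_less_iff[OF carrier sym n])
  \<comment> \<open>The scaling factor 2 turns \<open>D + 1/2\<close> into
    \<open>2 D + 1\<close>.\<close>
  also have "\<dots> \<longleftrightarrow> lorentzian (pverts G) (dist_form G)"
    by (rule lorentzian_bij[OF _ bij, of 2])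
       (use vs D in \<open>auto simp: dist_form_def nth_eq_iff_index_eq\<close>)
  finally show ?thesis .
qed

end

section \<open>Partitions whose clique cannot be enlarged\<close>

lemma (in connected_split) absorb:
  assumes i: "i \<in> I" and N: "N i = K"
  shows "is_clique G (insert i K)" "is_independent G (I - {i})"
    "insert i K \<union> (I - {i}) = pverts G" "insert i K \<inter> (I - {i}) = {}"
    "card (insert i K) = Suc (card K)"
proof -
  have "(i, c) \<in> parcs G" "(c, i) \<in> parcs G" if "c \<in> K" for c
    using that N arc_sym[of i c] by (auto simp: N_def)
  then show "is_clique G (insert i K)"
    using clique I_sub[OF i] by (auto simp: is_clique_def)
  show "is_independent G (I - {i})"
    using indep by (auto simp: is_independent_def)
  show "insert i K \<union> (I - {i}) = pverts G" "insert i K \<inter> (I - {i}) = {}"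
    using i cover disj by auto
  show "card (insert i K) = Suc (card K)"
    using fin_K i disj by (subst card_insert_disjoint) auto
qed

text \<open>The condition provides each vertex of \<open>I\<close> with a nonneighbour in
  \<open>K\<close>, which the forbidden configurations require. It also removes an ambiguity: for a
  complete graph, for example, it makes \<open>I\<close> empty.\<close>

locale maximal_split = connected_split +
  assumes proper: "i \<in> I \<Longrightarrow> N i \<noteq> K"
begin

lemma N_psub: "i \<in> I \<Longrightarrow> N i \<subset> K"
  using N_sub proper by blast

text \<open>A one-element set has no nonempty proper subset to serve as \<open>N i\<close>, so
  \<open>I\<close> would be empty and the graph would have a single vertex.\<close>

lemma card_K: "card K \<ge> 2"
proof (rule ccontr)
  assume "\<not> card K \<ge> 2"
  then have "card K = 0 \<or> card K = 1"
    by linarith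
  moreover have "K \<noteq> {}"
  proof
    assume "K = {}"
    then have "I = {}"
      using N_nonempty N_sub by blast
    with \<open>K = {}\<close> show False
      using card_ge_2 cover[symmetric] by simp
  qed
  ultimately have "card K = 1"
    using fin_K by simp
  then obtain c where c: "K = {c}"
    by (rule card_1_singletonE)
  then have "I = {}"
    using N_psub N_nonempty by blast
  then have "pverts G = {c}"
    using c cover by simp
  then show False
    using card_ge_2 by simp
qed

end

lemma maximal_split_exists:
  assumes G: "pair_graph G" "connected (with_proj G)" "card (pverts G) \<ge> 2" "split_graph G"
  obtains K I where "maximal_split G K I"
proof -
  interpret pair_graph G by fact
  define S where "S = {(K, I). is_clique G K \<and> is_independent G I \<and> K \<union> I = pverts G \<and> K \<inter> I = {}}"
  obtain K0 I0 where KI0: "(K0, I0) \<in> S"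
    using G(4) by (auto simp: split_graph_def S_def)
  have "card (fst p) < Suc (card (pverts G))" if "p \<in> S" for p
    using that card_mono[OF pair_finite_verts, of "fst p"]
    by (auto simp: less_Suc_eq_le is_clique_def S_def)
  then obtain p where p: "p \<in> S" "\<And>q. q \<in> S \<Longrightarrow> card (fst q) \<le> card (fst p)"
    using ex_has_greatest_nat[of "\<lambda>p. p \<in> S" _ "\<lambda>p. card (fst p)", OF KI0] by blast
  obtain K I where KI: "p = (K, I)"
    by fastforce
  then have S: "is_clique G K" "is_independent G I" "K \<union> I = pverts G" "K \<inter> I = {}"
    using p(1) by (auto simp: S_def)
  have split: "connected_split G K I"
    using G S by (intro connected_split.intro connected_split_axioms.intro) auto
  have "connected_split.N G K i \<noteq> K" if i: "i \<in> I" for i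
  proof
    assume N: "connected_split.N G K i = K"
    note ext = connected_split.absorb[OF split i N]
    have "(insert i K, I - {i}) \<in> S"
      using ext by (simp add: S_def)
    then show False
      using p(2) KI ext(5) by fastforce
  qed
  then have "maximal_split G K I"
    using split by (intro maximal_split.intro maximal_split_axioms.intro) auto
  then show ?thesis
    by (rule that)
qed

section \<open>Codes for split graphs\<close>

text \<open>The set \<open>L ! k\<close> is the neighbourhood of the vertex \<open>s + k\<close>
  outside the clique. The numbering matches that of \<open>attach_pendant\<close>, which takes the
  next free number, so the named graphs are equal to codes and not merely isomorphic to
  them.\<close>

definition split_code :: "nat \<Rightarrow> nat set list \<Rightarrow> nat pair_pre_digraph" where
  "split_code s L =
     \<lparr> pverts = {..<s + length L},
       parcs = {(i, j). i < s \<and> j < s \<and> i \<noteq> j}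
         \<union> {(i, j). i < s \<and> s \<le> j \<and> j < s + length L \<and> i \<in> L ! (j - s)}
         \<union> {(j, i). i < s \<and> s \<le> j \<and> j < s + length L \<and> i \<in> L ! (j - s)} \<rparr>"

lemma pverts_split_code [simp]: "pverts (split_code s L) = {..<s + length L}"
  by (simp add: split_code_def)

lemma parcs_split_code_sub: "parcs (split_code s L) \<subseteq> pverts (split_code s L) \<times> pverts (split_code s L)"
  by (auto simp: split_code_def)

lemma parcs_split_code [simp]:
  "c < s \<Longrightarrow> d < s \<Longrightarrow> (c, d) \<in> parcs (split_code s L) \<longleftrightarrow> c \<noteq> d"
  "c < s \<Longrightarrow> k < length L \<Longrightarrow> (c, s + k) \<in> parcs (split_code s L) \<longleftrightarrow> c \<in> L ! k"
  "c < s \<Longrightarrow> k < length L \<Longrightarrow> (s + k, c) \<in> parcs (split_code s L) \<longleftrightarrow> c \<in> L ! k"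
  "(s + k, s + l) \<notin> parcs (split_code s L)"
  by (auto simp: split_code_def)

lemma complete_graph_eq_split_code: "complete_graph s = split_code s []"
  by (auto simp: complete_graph_def split_code_def)

lemma attach_pendant_split_code:
  assumes "u < s"
  shows "attach_pendant u (split_code s L) = split_code s (L @ [{u}])"
proof -
  let ?n = "s + length L" and ?L' = "L @ [{u}]"
  \<comment> \<open>Here \<open>u < s\<close> guarantees a nonempty vertex set, so that the maximum
    is meaningful.\<close>
  have "Max {..<?n} = ?n - 1"
    by (rule Max_eqI) (use assms in auto)
  then have max: "Suc (Max {..<?n}) = ?n"
    using assms by simp
  have nth: "?L' ! (j - s) = (if j < ?n then L ! (j - s) else {u})" if "s \<le> j"
      "j < Suc ?n" for j
    using that by (auto simp: nth_append less_Suc_eq)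
  have "(a, b) \<in> parcs (split_code s L) \<union> {(u, ?n), (?n, u)} \<longleftrightarrow> (a, b) \<in> parcs (split_code s ?L')"
    for a b
    using assms nth[of a] nth[of b]
    by (cases "a = ?n"; cases "b = ?n") (auto simp: split_code_def less_Suc_eq)
  then have "parcs (split_code s L) \<union> {(u, ?n), (?n, u)} = parcs (split_code s ?L')"
    by auto
  moreover have "insert ?n {..<?n} = pverts (split_code s ?L')"
    by auto
  ultimately show ?thesis
    using max by (simp add: attach_pendant_def)
qed

lemma attach_pendants_split_code:
  assumes "u < s"
  shows "attach_pendants k u (split_code s L) = split_code s (L @ replicate k {u})"
  by (induction k)
     (simp_all add: attach_pendants_def attach_pendant_split_code[OF assms]
       flip: replicate_append_same)

lemma clique_pendants_eq_split_code:
  assumes "length xs \<le> s"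
  shows "clique_pendants s xs
    = split_code s (concat (map (\<lambda>i. replicate (xs ! i) {i}) [0..<length xs]))"
proof -
  have "fold (\<lambda>i. attach_pendants (xs ! i) i) [0..<k] (complete_graph s)
      = split_code s (concat (map (\<lambda>i. replicate (xs ! i) {i}) [0..<k]))" if "k \<le> s" for k
    using that
    by (induction k) (simp_all add: complete_graph_eq_split_code attach_pendants_split_code)
  then show ?thesis
    using assms by (simp add: clique_pendants_def)
qed

lemma clique_pendants_single: "s \<ge> 1 \<Longrightarrow> clique_pendants s [t] = split_code s (replicate t {0})"
  by (simp add: clique_pendants_eq_split_code)

lemma clique_pendants_pair:
  "s \<ge> 2 \<Longrightarrow> clique_pendants s [a, 1] = split_code s (replicate a {0} @ [{1}])"
  by (simp add: clique_pendants_eq_split_code upt_rec[of 0 2] numeral_2_eq_2)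

lemma clique_pendants_ones:
  "t \<le> s \<Longrightarrow> clique_pendants s (replicate t 1) = split_code s (map (\<lambda>i. {i}) [0..<t])"
proof -
  assume t: "t \<le> s"
  have "map (\<lambda>i. replicate (replicate t 1 ! i) {i}) [0..<t] = map (\<lambda>i. [{i}]) [0..<t]"
    by (intro map_cong) auto
  then show "clique_pendants s (replicate t 1) = split_code s (map (\<lambda>i. {i}) [0..<t])"
    using t by (simp only: clique_pendants_eq_split_code length_replicate concat_map_singleton)
qed

text \<open>With the edge between 2 and 3 missing, vertex 3 is the outside vertex of the clique on
  0, 1, 2.\<close>

lemma theta221_eq_split_code: "theta221 = split_code 3 [{0, 1}]"
  by (auto simp: theta221_def complete_graph_def split_code_def less_Suc_eq numeral_eq_Suc)

lemma SP0_eq_split_code: "SP0 = split_code 4 [{0, 1}]"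
  by (auto simp: SP0_def complete_graph_def split_code_def less_Suc_eq numeral_eq_Suc)

lemma B_theta_eq_split_code: "B_theta k = split_code 3 ({0, 1} # replicate k {0})"
  by (simp add: B_theta_def theta221_eq_split_code attach_pendants_split_code)

lemma SP_sup_eq_split_code: "SP_sup k = split_code 4 ({0, 1} # replicate k {0})"
  by (simp add: SP_sup_def SP0_eq_split_code attach_pendants_split_code)

lemma B6_eq_split_code: "B6 = split_code 3 ({0, 1} # replicate 1 {0} @ [{1}])"
  by (simp add: B6_def theta221_eq_split_code attach_pendants_split_code)

lemma B7_eq_split_code: "B7 = split_code 3 ({0, 1} # replicate 2 {0} @ [{1}])"
  by (simp add: B7_def theta221_eq_split_code attach_pendants_split_code)

lemma SP2_eq_split_code: "SP2 = split_code 4 ({0, 1} # replicate 1 {0} @ [{1}])"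
  by (simp add: SP2_def SP0_eq_split_code attach_pendants_split_code)

lemma SP1_eq_split_code: "SP1 = split_code 4 ({0, 1} # replicate 2 {0} @ [{1}])"
  by (simp add: SP1_def SP0_eq_split_code attach_pendants_split_code)

section \<open>The form of a code in coordinates\<close>

lemma dist_form_split_code:
  assumes L: "\<And>k. k < length L \<Longrightarrow> L ! k \<noteq> {} \<and> L ! k \<subseteq> {..<s}"
  shows "c < s \<Longrightarrow> d < s \<Longrightarrow> dist_form (split_code s L) c d = (if c = d then 1 else 2)"
    and "c < s \<Longrightarrow> k < length L \<Longrightarrow> dist_form (split_code s L) c (s + k) = (if c \<in> L ! k then 2 else 4)"
    and "c < s \<Longrightarrow> k < length L \<Longrightarrow> dist_form (split_code s L) (s + k) c = (if c \<in> L ! k then 2 else 4)"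
    and "k < length L \<Longrightarrow> l < length L \<Longrightarrow> dist_form (split_code s L) (s + k) (s + l)
      = (if k = l then 1 else if L ! k \<inter> L ! l \<noteq> {} then 4 else 6)"
proof -
  show "dist_form (split_code s L) c d = (if c = d then 1 else 2)" if "c < s" "d < s"
    using that by (auto simp: dist_form_def near_dist_def)
  have "\<exists>d. (c, d) \<in> parcs (split_code s L) \<and> (d, s + k) \<in> parcs (split_code s L)"
    and "\<exists>d. (s + k, d) \<in> parcs (split_code s L) \<and> (d, c) \<in> parcs (split_code s L)"
    if ck: "c < s" "k < length L" "c \<notin> L ! k"
  proof -
    obtain d where "d \<in> L ! k" "d < s"
      using L[OF ck(2)] by blast
    then show "\<exists>d. (c, d) \<in> parcs (split_code s L) \<and> (d, s + k) \<in> parcs (split_code s L)"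
      and "\<exists>d. (s + k, d) \<in> parcs (split_code s L) \<and> (d, c) \<in> parcs (split_code s L)"
      using ck by (auto intro!: exI[of _ d])
  qed
  then show "dist_form (split_code s L) c (s + k) = (if c \<in> L ! k then 2 else 4)"
    and "dist_form (split_code s L) (s + k) c = (if c \<in> L ! k then 2 else 4)"
    if "c < s" "k < length L"
    using that by (auto simp: dist_form_def near_dist_def)
  show "dist_form (split_code s L) (s + k) (s + l)
      = (if k = l then 1 else if L ! k \<inter> L ! l \<noteq> {} then 4 else 6)"
    if kl: "k < length L" "l < length L"
  proof -
    have "(\<exists>d. (s + k, d) \<in> parcs (split_code s L) \<and> (d, s + l) \<in> parcs (split_code s L))
        \<longleftrightarrow> L ! k \<inter> L ! l \<noteq> {}"
    proof
      assume "\<exists>d. (s + k, d) \<in> parcs (split_code s L) \<and> (d, s + l) \<in> parcs (split_code s L)"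
      then show "L ! k \<inter> L ! l \<noteq> {}"
        by (auto simp: split_code_def)
    next
      assume "L ! k \<inter> L ! l \<noteq> {}"
      then obtain d where "d \<in> L ! k" "d \<in> L ! l" "d < s"
        using L[OF kl(1)] by blast
      then show "\<exists>d. (s + k, d) \<in> parcs (split_code s L) \<and> (d, s + l) \<in> parcs (split_code s L)"
        using kl by (intro exI[of _ d]) auto
    qed
    then show ?thesis
      by (simp add: dist_form_def near_dist_def)
  qed
qed

lemma sum_lessThan_add: "sum f {..<m + n} = sum f {..<m} + (\<Sum>k<n. f (m + k))"
  for f :: "nat \<Rightarrow> 'b :: comm_monoid_add"
  by (induction n) (simp_all add: add.assoc)

text \<open>The matrix is split into constant blocks 2, 4 and 6 minus corrections, so that the
  constants enter through the total weights \<open>\<sigma>\<close> and \<open>\<tau>\<close>.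
  Neighbourhoods are nonempty, so the last double sum includes the pairs \<open>k = l\<close>; the
  diagonal entry 1 arises as 6 - 3 - 2.\<close>

lemma split_code_form:
  fixes y :: "nat \<Rightarrow> real"
  assumes L: "\<And>k. k < length L \<Longrightarrow> L ! k \<noteq> {} \<and> L ! k \<subseteq> {..<s}"
  defines "m \<equiv> dist_form (split_code s L)" and "n \<equiv> length L"
  defines "\<sigma> \<equiv> \<Sum>c<s. y c" and "\<tau> \<equiv> \<Sum>k<n. y (s + k)"
  shows "(\<Sum>u<s + n. \<Sum>v<s + n. m u v * y u * y v)
    = 2 * \<sigma>\<^sup>2 - (\<Sum>c<s. (y c)\<^sup>2) + 8 * \<sigma> * \<tau> - 4 * (\<Sum>k<n. y (s + k) * (\<Sum>c\<in>L ! k. y c))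
      + 6 * \<tau>\<^sup>2 - 3 * (\<Sum>k<n. (y (s + k))\<^sup>2)
      - 2 * (\<Sum>k<n. \<Sum>l<n. if L ! k \<inter> L ! l \<noteq> {} then y (s + k) * y (s + l) else 0)"
proof -
  note m = dist_form_split_code[OF L, folded m_def n_def]
  define M where "M k = (\<Sum>c\<in>L ! k. y c)" for k
  have KK: "(\<Sum>d<s. m c d * y c * y d) = 2 * y c * \<sigma> - (y c)\<^sup>2" if "c < s" for c
  proof -
    have "(\<Sum>d<s. m c d * y c * y d) = (\<Sum>d<s. 2 * y c * y d - (if c = d then (y c)\<^sup>2 else 0))"
      using that by (intro sum.cong) (auto simp: m power2_eq_square)
    then show ?thesis
      using that by (simp add: sum_subtractf \<sigma>_def flip: sum_distrib_left)
  qed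
  have "(\<Sum>c<s. (if c \<in> L ! k then 2 else 4) * y c * y (s + k)) = 4 * \<sigma> * y (s + k) - 2 * (y (s + k) * M k)"
    if k: "k < n" for k
  proof -
    have "(\<Sum>c<s. (if c \<in> L ! k then 2 else 4) * y c * y (s + k))
        = (\<Sum>c<s. 4 * y (s + k) * y c - 2 * y (s + k) * (if c \<in> L ! k then y c else 0))"
      by (intro sum.cong) auto
    also have "\<dots> = 4 * y (s + k) * \<sigma> - 2 * y (s + k) * (\<Sum>c<s. if c \<in> L ! k then y c else 0)"
      by (simp add: sum_subtractf \<sigma>_def flip: sum_distrib_left)
    also have "(\<Sum>c<s. if c \<in> L ! k then y c else 0) = M k"
      unfolding M_def using L[of k] k by (subst sum.inter_restrict[symmetric]) (auto simp: n_def Int_absorb1)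
    finally show ?thesis
      by (simp add: mult_ac)
  qed
  then have KI: "(\<Sum>c<s. m c (s + k) * y c * y (s + k)) = 4 * \<sigma> * y (s + k) - 2 * (y (s + k) * M k)"
    and IK: "(\<Sum>c<s. m (s + k) c * y (s + k) * y c) = 4 * \<sigma> * y (s + k) - 2 * (y (s + k) * M k)"
    if "k < n" for k
    using that by (simp_all add: m mult_ac)
  have II: "(\<Sum>l<n. m (s + k) (s + l) * y (s + k) * y (s + l)) = 6 * y (s + k) * \<tau> - 3 * (y (s + k))\<^sup>2
      - 2 * (\<Sum>l<n. if L ! k \<inter> L ! l \<noteq> {} then y (s + k) * y (s + l) else 0)" if k: "k < n" for k
  proof -
    have "L ! k \<noteq> {}"
      using k L by (simp add: n_def)
    then have "(\<Sum>l<n. m (s + k) (s + l) * y (s + k) * y (s + l))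
        = (\<Sum>l<n. 6 * y (s + k) * y (s + l) - (if k = l then 3 * (y (s + k))\<^sup>2 else 0)
            - 2 * (if L ! k \<inter> L ! l \<noteq> {} then y (s + k) * y (s + l) else 0))"
      using k by (intro sum.cong) (auto simp: m power2_eq_square)
    then show ?thesis
      using k by (simp add: sum_subtractf \<tau>_def flip: sum_distrib_left)
  qed
  have "(\<Sum>u<s + n. \<Sum>v<s + n. m u v * y u * y v)
      = (\<Sum>c<s. \<Sum>d<s. m c d * y c * y d) + (\<Sum>c<s. \<Sum>k<n. m c (s + k) * y c * y (s + k))
      + ((\<Sum>k<n. \<Sum>c<s. m (s + k) c * y (s + k) * y c)
        + (\<Sum>k<n. \<Sum>l<n. m (s + k) (s + l) * y (s + k) * y (s + l)))"
    by (simp add: sum_lessThan_add sum.distrib)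
  also have "(\<Sum>c<s. \<Sum>k<n. m c (s + k) * y c * y (s + k))
      = (\<Sum>k<n. \<Sum>c<s. m c (s + k) * y c * y (s + k))"
    by (rule sum.swap)
  also have "(\<Sum>c<s. \<Sum>d<s. m c d * y c * y d) = (\<Sum>c<s. 2 * y c * \<sigma> - (y c)\<^sup>2)"
    by (intro sum.cong) (simp_all add: KK)
  also have "\<dots> = 2 * \<sigma>\<^sup>2 - (\<Sum>c<s. (y c)\<^sup>2)"
    by (simp add: sum_subtractf power2_eq_square \<sigma>_def sum_distrib_left sum_distrib_right mult_ac)
  also have "(\<Sum>k<n. \<Sum>c<s. m c (s + k) * y c * y (s + k))
      = (\<Sum>k<n. 4 * \<sigma> * y (s + k) - 2 * (y (s + k) * M k))"
    by (intro sum.cong) (simp_all add: KI)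
  also have "(\<Sum>k<n. \<Sum>c<s. m (s + k) c * y (s + k) * y c)
      = (\<Sum>k<n. 4 * \<sigma> * y (s + k) - 2 * (y (s + k) * M k))"
    by (intro sum.cong) (simp_all add: IK)
  also have "(\<Sum>k<n. 4 * \<sigma> * y (s + k) - 2 * (y (s + k) * M k))
      = 4 * \<sigma> * \<tau> - 2 * (\<Sum>k<n. y (s + k) * M k)"
    by (simp add: sum_subtractf \<tau>_def flip: sum_distrib_left)
  also have "(\<Sum>k<n. \<Sum>l<n. m (s + k) (s + l) * y (s + k) * y (s + l))
      = (\<Sum>k<n. 6 * \<tau> * y (s + k) - 3 * (y (s + k))\<^sup>2
         - 2 * (\<Sum>l<n. if L ! k \<inter> L ! l \<noteq> {} then y (s + k) * y (s + l) else 0))"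
    by (intro sum.cong) (simp_all add: II)
  also have "\<dots> = 6 * \<tau>\<^sup>2 - 3 * (\<Sum>k<n. (y (s + k))\<^sup>2)
      - 2 * (\<Sum>k<n. \<Sum>l<n. if L ! k \<inter> L ! l \<noteq> {} then y (s + k) * y (s + l) else 0)"
    by (simp add: sum_subtractf \<tau>_def power2_eq_square flip: sum_distrib_left)
  finally show ?thesis
    unfolding M_def by simp
qed

section \<open>The listed graphs\<close>

abbreviation lorentzian_code :: "nat \<Rightarrow> nat set list \<Rightarrow> bool" where
  "lorentzian_code s L \<equiv>
     lorentzian (pverts (split_code s L)) (dist_form (split_code s L))"

lemma all_lessThan_add: "(\<forall>v\<in>{..<s + n}. P v) \<longleftrightarrow> (\<forall>c<s. P c) \<and> (\<forall>k<n. P (s + k))"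
  for s n :: nat
  by (auto simp: not_less) (metis add_less_cancel_left le_Suc_ex not_less)

lemma lorentzian_codeI:
  fixes s :: nat and L :: "nat set list"
  defines "n \<equiv> length L"
  assumes L: "\<And>k. k < n \<Longrightarrow> L ! k \<noteq> {} \<and> L ! k \<subseteq> {..<s}"
    and *: "\<And>y z :: nat \<Rightarrow> real. (\<Sum>c<s. w c * y c) + (\<Sum>k<n. w (s + k) * z k) = 0 \<Longrightarrow>
      0 \<le> 2 * (\<Sum>c<s. y c)\<^sup>2 - (\<Sum>c<s. (y c)\<^sup>2) + 8 * (\<Sum>c<s. y c) * (\<Sum>k<n. z k)
        - 4 * (\<Sum>k<n. z k * (\<Sum>c\<in>L ! k. y c)) + 6 * (\<Sum>k<n. z k)\<^sup>2 - 3 * (\<Sum>k<n. (z k)\<^sup>2)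
        - 2 * (\<Sum>k<n. \<Sum>l<n. if L ! k \<inter> L ! l \<noteq> {} then z k * z l else 0) \<Longrightarrow>
      (\<forall>c<s. y c = 0) \<and> (\<forall>k<n. z k = 0)"
  shows "lorentzian_code s L"
proof (rule lorentzianI[where w = w])
  fix y :: "nat \<Rightarrow> real"
  assume orth: "(\<Sum>v\<in>pverts (split_code s L). w v * y v) = 0"
    and form: "0 \<le> (\<Sum>u\<in>pverts (split_code s L). \<Sum>v\<in>pverts (split_code s L).
      dist_form (split_code s L) u v * y u * y v)"
  have "(\<forall>c<s. y c = 0) \<and> (\<forall>k<n. y (s + k) = 0)"
  proof (rule *)
    show "(\<Sum>c<s. w c * y c) + (\<Sum>k<n. w (s + k) * y (s + k)) = 0"
      using orth by (simp add: sum_lessThan_add n_def)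
  qed (use form split_code_form[OF L[unfolded n_def], of y] in \<open>simp add: n_def\<close>)
  then show "\<forall>v\<in>pverts (split_code s L). y v = 0"
    by (simp add: all_lessThan_add n_def)
qed

lemma sum_squares_le_0D:
  fixes f :: "'b \<Rightarrow> real"
  assumes "finite A" "(\<Sum>x\<in>A. (f x)\<^sup>2) \<le> 0" "x \<in> A"
  shows "f x = 0"
  using assms sum_nonneg_eq_0_iff[of A "\<lambda>x. (f x)\<^sup>2"] sum_nonneg[of A "\<lambda>x. (f x)\<^sup>2"] by auto

lemma sum_lessThan_split2:
  fixes f :: "nat \<Rightarrow> real"
  assumes "s \<ge> 2"
  shows "(\<Sum>c<s. f c) = f 0 + f 1 + (\<Sum>c\<in>{2..<s}. f c)"
proof -
  have "{..<s} = {0, 1} \<union> {2..<s}"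
    using assms by auto
  then show ?thesis
    by (simp add: sum.union_disjoint)
qed

text \<open>All outside neighbourhoods meet, and the form is
  \<open>2 (\<sigma> + 2 \<tau>)^2 - (y 0 + 2 \<tau>)^2 - R - 3 Z\<close>. The hyperplane
  \<open>\<sigma> + 2 \<tau> = 0\<close> removes its one positive square.\<close>

lemma lorentzian_code_star:
  assumes s: "s \<ge> 2"
  shows "lorentzian_code s (replicate t {0})"
proof (rule lorentzian_codeI[where w = "\<lambda>v. if v < s then 1 else 2"])
  let ?L = "replicate t {0} :: nat set list"
  fix y z :: "nat \<Rightarrow> real"
  define \<sigma> \<tau> R Z where "\<sigma> = (\<Sum>c<s. y c)" and "\<tau> = (\<Sum>k<t. z k)"
    and "R = (\<Sum>c\<in>{1..<s}. (y c)\<^sup>2)" and "Z = (\<Sum>k<t. (z k)\<^sup>2)"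
  have sq: "(\<Sum>c<s. (y c)\<^sup>2) = (y 0)\<^sup>2 + R"
    using s by (simp add: R_def lessThan_atLeast0 sum.atLeast_Suc_lessThan)
  have pos: "R \<ge> 0" "Z \<ge> 0"
    by (simp_all add: R_def Z_def sum_nonneg)
  assume "(\<Sum>c<s. (if c < s then 1 else 2) * y c)
      + (\<Sum>k<length ?L. (if s + k < s then 1 else 2) * z k) = 0"
  then have S: "\<sigma> = - 2 * \<tau>"
    by (simp add: \<sigma>_def \<tau>_def flip: sum_distrib_left)
  have meet: "(\<Sum>k<t. \<Sum>l<t. if ?L ! k \<inter> ?L ! l \<noteq> {}
      then z k * z l else 0) = \<tau>\<^sup>2"
  proof -
    have "(\<Sum>k<t. \<Sum>l<t. if ?L ! k \<inter> ?L ! l \<noteq> {}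
        then z k * z l else 0) = (\<Sum>k<t. \<Sum>l<t. z k * z l)"
      by (intro sum.cong refl) auto
    then show ?thesis
      by (simp only: \<tau>_def sum_product power2_eq_square)
  qed
  have cross: "(\<Sum>k<t. z k * (\<Sum>c\<in>?L ! k. y c)) = \<tau> * y 0"
    by (simp add: \<tau>_def sum_distrib_right)
  assume "0 \<le> 2 * (\<Sum>c<s. y c)\<^sup>2 - (\<Sum>c<s. (y c)\<^sup>2)
      + 8 * (\<Sum>c<s. y c) * (\<Sum>k<length ?L. z k)
      - 4 * (\<Sum>k<length ?L. z k * (\<Sum>c\<in>?L ! k. y c))
      + 6 * (\<Sum>k<length ?L. z k)\<^sup>2 - 3 * (\<Sum>k<length ?L. (z k)\<^sup>2)
      - 2 * (\<Sum>k<length ?L. \<Sum>l<length ?L.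
          if ?L ! k \<inter> ?L ! l \<noteq> {} then z k * z l else 0)"
  also have "\<dots> = 2 * \<sigma>\<^sup>2 - ((y 0)\<^sup>2 + R) + 8 * \<sigma> * \<tau> - 4 * (\<tau> * y 0) + 6 * \<tau>\<^sup>2 - 3 * Z - 2 * \<tau>\<^sup>2"
    by (simp only: length_replicate meet cross sq \<sigma>_def \<tau>_def Z_def)
  also have "\<dots> = - ((y 0 + 2 * \<tau>)\<^sup>2 + R + 3 * Z)"
    by (simp add: S power2_eq_square algebra_simps)
  finally have le: "(y 0 + 2 * \<tau>)\<^sup>2 + R + 3 * Z \<le> 0"
    by simp
  then have "R \<le> 0" "Z \<le> 0" "(y 0 + 2 * \<tau>)\<^sup>2 \<le> 0"
    using pos zero_le_power2[of "y 0 + 2 * \<tau>"] by linarith+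
  then have y0: "y 0 = - 2 * \<tau>"
    by simp
  then have z: "z k = 0" if "k < t" for k
    using sum_squares_le_0D[of "{..<t}" z k] that \<open>Z \<le> 0\<close> by (simp add: Z_def)
  have y: "y c = 0" if "1 \<le> c" "c < s" for c
    using sum_squares_le_0D[of "{1..<s}" y c] that \<open>R \<le> 0\<close> by (simp add: R_def)
  have "y c = 0" if "c < s" for c
    using y[of c] that y0 z by (cases "c = 0") (auto simp: \<tau>_def)
  then show "(\<forall>c<s. y c = 0) \<and> (\<forall>k<length ?L. z k = 0)"
    using z by simp
qed (use s in auto)

text \<open>On the hyperplane that removes the square \<open>2 (\<sigma> + 2 \<tau>)^2\<close>,
  where \<open>\<tau>\<close> is the outside weight, the clique coordinates are absorbed by squares
  and \<open>- 3 (p^2 + q^2 + r^2) - 4 (p + q) r\<close> remains. Completing the square in each of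
  the \<open>a\<close> pendant coordinates at 0 returns \<open>4/3 r^2\<close>, in total
  \<open>4 a / 3 r^2\<close> against \<open>- 3 r^2\<close>: negative for \<open>a = 1\<close> and
  \<open>a = 2\<close>, but not for three pendants.\<close>

lemma lorentzian_code_two_stars:
  assumes s: "s \<ge> 2" and a: "a \<in> {1, 2}"
  shows "lorentzian_code s (replicate a {0} @ [{1}])"
proof (rule lorentzian_codeI[where w = "\<lambda>v. if v < s then 1 else 2"])
  let ?L = "replicate a {0} @ [{1}] :: nat set list"
  fix y z :: "nat \<Rightarrow> real"
  \<comment> \<open>Setting \<open>q\<close> to 0 when there is a single pendant at 0 lets one
    identity serve both values of \<open>a\<close>.\<close>
  define p q r where "p = z 0" and "q = (if a = 2 then z 1 else 0)" and "r = z a"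
  define \<sigma> R where "\<sigma> = (\<Sum>c<s. y c)" and "R = (\<Sum>c\<in>{2..<s}. (y c)\<^sup>2)"
  have sq: "(\<Sum>c<s. (y c)\<^sup>2) = (y 0)\<^sup>2 + (y 1)\<^sup>2 + R"
    using s by (simp add: R_def sum_lessThan_split2)
  have pos: "R \<ge> 0"
    by (simp add: R_def sum_nonneg)
  assume "(\<Sum>c<s. (if c < s then 1 else 2) * y c)
      + (\<Sum>k<length ?L. (if s + k < s then 1 else 2) * z k) = 0"
  then have S: "\<sigma> = - 2 * (p + q + r)"
    using a by (auto simp: \<sigma>_def p_def q_def r_def numeral_2_eq_2)
  assume "0 \<le> 2 * (\<Sum>c<s. y c)\<^sup>2 - (\<Sum>c<s. (y c)\<^sup>2)
      + 8 * (\<Sum>c<s. y c) * (\<Sum>k<length ?L. z k)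
      - 4 * (\<Sum>k<length ?L. z k * (\<Sum>c\<in>?L ! k. y c))
      + 6 * (\<Sum>k<length ?L. z k)\<^sup>2 - 3 * (\<Sum>k<length ?L. (z k)\<^sup>2)
      - 2 * (\<Sum>k<length ?L. \<Sum>l<length ?L.
          if ?L ! k \<inter> ?L ! l \<noteq> {} then z k * z l else 0)"
  also have "\<dots> = 2 * \<sigma>\<^sup>2 - ((y 0)\<^sup>2 + (y 1)\<^sup>2 + R) + 8 * \<sigma> * (p + q + r)
      - 4 * ((p + q) * y 0 + r * y 1) + 6 * (p + q + r)\<^sup>2 - 3 * (p\<^sup>2 + q\<^sup>2 + r\<^sup>2)
      - 2 * ((p + q)\<^sup>2 + r\<^sup>2)"
    using a unfolding sq \<sigma>_def[symmetric]
    by (auto simp: p_def q_def r_def numeral_2_eq_2 power2_eq_square algebra_simps)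
  also have "\<dots> = - ((y 0 + 2 * (p + q))\<^sup>2 + (y 1 + 2 * r)\<^sup>2 + R
      + 3 * (p + 2 / 3 * r)\<^sup>2 + 3 * (q + 2 / 3 * r)\<^sup>2 + 1 / 3 * r\<^sup>2)"
    by (simp add: S power2_eq_square algebra_simps)
  finally have le: "(y 0 + 2 * (p + q))\<^sup>2 + (y 1 + 2 * r)\<^sup>2 + R
      + 3 * (p + 2 / 3 * r)\<^sup>2 + 3 * (q + 2 / 3 * r)\<^sup>2 + 1 / 3 * r\<^sup>2 \<le> 0"
    by simp
  have "r\<^sup>2 \<le> 0" "(p + 2 / 3 * r)\<^sup>2 \<le> 0" "(q + 2 / 3 * r)\<^sup>2 \<le> 0"
      "R \<le> 0" "(y 1 + 2 * r)\<^sup>2 \<le> 0"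
    "(y 0 + 2 * (p + q))\<^sup>2 \<le> 0"
    using le pos zero_le_power2[of "y 0 + 2 * (p + q)"] zero_le_power2[of "y 1 + 2 * r"]
      zero_le_power2[of "p + 2 / 3 * r"] zero_le_power2[of "q + 2 / 3 * r"] zero_le_power2[of r]
    by linarith+
  then have "r = 0" "p = 0" "q = 0" "y 0 = 0" "y 1 = 0" "R \<le> 0"
    by auto
  have y: "y c = 0" if "2 \<le> c" "c < s" for c
    using sum_squares_le_0D[of "{2..<s}" y c] that \<open>R \<le> 0\<close> by (simp add: R_def)
  have "y c = 0" if "c < s" for c
    using y[of c] that \<open>y 0 = 0\<close> \<open>y 1 = 0\<close> by (cases "c = 0 \<or> c = 1") auto
  moreover have "z k = 0" if "k < length ?L" for k
    using that a \<open>p = 0\<close> \<open>q = 0\<close> \<open>r = 0\<close>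
    by (auto simp: p_def q_def r_def less_Suc_eq numeral_2_eq_2)
  ultimately show "(\<forall>c<s. y c = 0) \<and> (\<forall>k<length ?L. z k = 0)"
    by blast
qed (use s a in \<open>auto simp: nth_append nth_Cons'\<close>)

text \<open>The neighbourhoods are pairwise disjoint, so the total weights occur only in \<open>2
  \<sigma>^2 + 8 \<sigma> \<tau> + 6 \<tau>^2 = 2 (\<sigma> + \<tau>) (\<sigma> + 3 \<tau>)\<close>,
  which vanishes on \<open>\<sigma> + \<tau> = 0\<close>. What is left decouples into one negative
  block for each pendant and its clique vertex, whatever their number.\<close>

lemma lorentzian_code_distinct_pendants:
  assumes t: "t \<le> s"
  shows "lorentzian_code s (map (\<lambda>i. {i}) [0..<t])"
proof (rule lorentzian_codeI[where w = "\<lambda>v. 1"])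
  let ?L = "map (\<lambda>i. {i}) [0..<t]"
  fix y z :: "nat \<Rightarrow> real"
  define \<sigma> \<tau> where "\<sigma> = (\<Sum>c<s. y c)" and "\<tau> = (\<Sum>k<t. z k)"
  define R where "R = (\<Sum>c\<in>{t..<s}. (y c)\<^sup>2)"
  have sq: "(\<Sum>c<s. (y c)\<^sup>2) = (\<Sum>c<t. (y c)\<^sup>2) + R"
    using t by (simp add: R_def lessThan_atLeast0 sum.atLeastLessThan_concat)
  have pos: "R \<ge> 0" "(\<Sum>k<t. (y k + 2 * z k)\<^sup>2) \<ge> 0"
      "(\<Sum>k<t. (z k)\<^sup>2) \<ge> 0"
    by (simp_all add: R_def sum_nonneg)
  assume "(\<Sum>c<s. 1 * y c) + (\<Sum>k<length ?L. 1 * z k) = 0"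
  then have S: "\<sigma> = - \<tau>"
    by (simp add: \<sigma>_def \<tau>_def)
  have meet: "(\<Sum>l<t. if ?L ! k \<inter> ?L ! l \<noteq> {} then z k * z l else 0) = (z k)\<^sup>2" if "k < t" for k
  proof -
    have "(\<Sum>l<t. if ?L ! k \<inter> ?L ! l \<noteq> {} then z k * z l else 0) = (\<Sum>l<t. if k = l then (z k)\<^sup>2 else 0)"
      using that by (intro sum.cong) (auto simp: power2_eq_square)
    then show ?thesis
      using that by simp
  qed
  assume "0 \<le> 2 * (\<Sum>c<s. y c)\<^sup>2 - (\<Sum>c<s. (y c)\<^sup>2)
      + 8 * (\<Sum>c<s. y c) * (\<Sum>k<length ?L. z k)
      - 4 * (\<Sum>k<length ?L. z k * (\<Sum>c\<in>?L ! k. y c))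
      + 6 * (\<Sum>k<length ?L. z k)\<^sup>2 - 3 * (\<Sum>k<length ?L. (z k)\<^sup>2)
      - 2 * (\<Sum>k<length ?L. \<Sum>l<length ?L.
          if ?L ! k \<inter> ?L ! l \<noteq> {} then z k * z l else 0)"
  also have "\<dots> = 2 * \<sigma>\<^sup>2 - ((\<Sum>c<t. (y c)\<^sup>2) + R) + 8 * \<sigma> * \<tau> - 4 * (\<Sum>k<t. z k * y k)
      + 6 * \<tau>\<^sup>2 - 3 * (\<Sum>k<t. (z k)\<^sup>2) - 2 * (\<Sum>k<t. (z k)\<^sup>2)"
    using meet by (simp add: sq \<sigma>_def \<tau>_def)
  also have "\<dots> = - (R + (\<Sum>k<t. (y k)\<^sup>2) + 4 * (\<Sum>k<t. z k * y k) + 5 * (\<Sum>k<t. (z k)\<^sup>2))"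
    by (simp add: S power2_eq_square algebra_simps)
  also have "\<dots> = - (R + (\<Sum>k<t. (y k + 2 * z k)\<^sup>2) + (\<Sum>k<t. (z k)\<^sup>2))"
  proof -
    have "(\<Sum>k<t. (y k + 2 * z k)\<^sup>2) + (\<Sum>k<t. (z k)\<^sup>2)
        = (\<Sum>k<t. (y k)\<^sup>2 + 4 * (z k * y k) + 5 * (z k)\<^sup>2)"
      unfolding sum.distrib[symmetric]
      by (intro sum.cong) (auto simp: power2_eq_square algebra_simps)
    then show ?thesis
      by (simp add: sum.distrib flip: sum_distrib_left)
  qed
  finally have le: "R + (\<Sum>k<t. (y k + 2 * z k)\<^sup>2) + (\<Sum>k<t. (z k)\<^sup>2) \<le> 0"
    by simp
  then have le': "R \<le> 0" "(\<Sum>k<t. (y k + 2 * z k)\<^sup>2) \<le> 0" "(\<Sum>k<t. (z k)\<^sup>2) \<le> 0"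
    using pos by linarith+
  have z: "z k = 0" if "k < t" for k
    using sum_squares_le_0D[OF _ le'(3), of k] that by simp
  have y1: "y k = 0" if "k < t" for k
    using sum_squares_le_0D[OF _ le'(2), of k] that z by simp
  have y2: "y k = 0" if "t \<le> k" "k < s" for k
    using sum_squares_le_0D[OF _ le'(1)[unfolded R_def], of k] that by simp
  show "(\<forall>c<s. y c = 0) \<and> (\<forall>k<length ?L. z k = 0)"
    using z y1 y2 by (metis diff_zero length_map length_upt not_less)
qed (use t in auto)

text \<open>The inequality holds because \<open>2/16 + 1 < 81/64\<close>.\<close>

lemma form_margin:
  fixes w A B c d P :: real
  assumes "A + B + c + d = 9 / 4 * w" "P \<ge> 0"
    and "0 \<le> 2 * (w / 4)\<^sup>2 + w\<^sup>2 - A\<^sup>2 - B\<^sup>2 - c\<^sup>2 - d\<^sup>2 - P"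
  shows "w = 0 \<and> A = 0 \<and> B = 0 \<and> c = 0 \<and> d = 0 \<and> P = 0"
proof -
  \<comment> \<open>Lagrange's identity against the all-ones vector: the proof of Cauchy-Schwarz for
    four numbers.\<close>
  have "4 * (A\<^sup>2 + B\<^sup>2 + c\<^sup>2 + d\<^sup>2) - (A + B + c + d)\<^sup>2
      = (A - B)\<^sup>2 + (A - c)\<^sup>2 + (A - d)\<^sup>2 + (B - c)\<^sup>2 + (B - d)\<^sup>2 + (c - d)\<^sup>2"
    by (simp add: power2_eq_square algebra_simps)
  then have "4 * (A\<^sup>2 + B\<^sup>2 + c\<^sup>2 + d\<^sup>2) \<ge> (9 / 4 * w)\<^sup>2"
    using zero_le_power2[of "A - B"] zero_le_power2[of "A - c"] zero_le_power2[of "A - d"]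
      zero_le_power2[of "B - c"] zero_le_power2[of "B - d"] zero_le_power2[of "c - d"]
    unfolding assms(1) by linarith
  \<comment> \<open>The margin is 9/64 = 81/64 - 2/16 - 1.\<close>
  then have "9 / 64 * w\<^sup>2 + P \<le> 0"
    using assms(3) by (simp add: power2_eq_square)
  then have "w\<^sup>2 \<le> 0" and P: "P = 0"
    using assms(2) zero_le_power2[of w] by linarith+
  then have w: "w = 0"
    by simp
  then have "A\<^sup>2 + B\<^sup>2 + c\<^sup>2 + d\<^sup>2 \<le> 0"
    using assms(3) P by simp
  then have "A\<^sup>2 = 0" "B\<^sup>2 = 0" "c\<^sup>2 = 0" "d\<^sup>2 = 0"
    using zero_le_power2[of A] zero_le_power2[of B] zero_le_power2[of c] zero_le_power2[of d]
    by linarith+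
  then show ?thesis
    using w P by simp
qed

text \<open>A clique of three vertices gets a fourth coordinate \<open>d = 0\<close>, so that both
  clique sizes share the estimate for four numbers.\<close>

lemma sum_lessThan_3_4:
  fixes y :: "nat \<Rightarrow> real"
  assumes s: "s = 3 \<or> s = 4"
  obtains c d where "(\<Sum>i<s. y i) = y 0 + y 1 + c + d"
    "(\<Sum>i<s. (y i)\<^sup>2) = (y 0)\<^sup>2 + (y 1)\<^sup>2 + c\<^sup>2 + d\<^sup>2"
    "y 0 = 0 \<Longrightarrow> y 1 = 0 \<Longrightarrow> c = 0 \<Longrightarrow> d = 0 \<Longrightarrow> \<forall>i<s. y i = 0"
proof (cases "s = 3")
  case True
  then show ?thesis
    using that[of "y 2" 0] by (simp add: eval_nat_numeral less_Suc_eq)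
next
  case False
  then show ?thesis
    using s that[of "y 2" "y 3"] by (simp add: eval_nat_numeral less_Suc_eq)
qed

text \<open>With \<open>S\<close> the weight of the clique plus twice the rest and \<open>w\<close> the weight of the vertex attached
  to both 0 and 1, the hyperplane is \<open>4 S = w\<close>.\<close>

lemma lorentzian_code_theta:
  assumes s: "s = 3 \<or> s = 4"
  shows "lorentzian_code s ({0, 1} # replicate t {0})"
proof (rule lorentzian_codeI[where w = "\<lambda>v. if v < s then 4 else if v = s then 7 else 8"])
  let ?L = "{0, 1} # replicate t {0} :: nat set list"
  fix y z :: "nat \<Rightarrow> real"
  define w \<sigma> \<rho> Z where "w = z 0" and "\<sigma> = (\<Sum>c<s. y c)" and "\<rho> = (\<Sum>k<t. z (Suc k))"
    and "Z = (\<Sum>k<t. (z (Suc k))\<^sup>2)"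
  obtain c d where cd: "(\<Sum>i<s. y i) = y 0 + y 1 + c + d"
    "(\<Sum>i<s. (y i)\<^sup>2) = (y 0)\<^sup>2 + (y 1)\<^sup>2 + c\<^sup>2 + d\<^sup>2"
    "y 0 = 0 \<Longrightarrow> y 1 = 0 \<Longrightarrow> c = 0 \<Longrightarrow> d = 0 \<Longrightarrow> \<forall>i<s. y i = 0"
    using sum_lessThan_3_4[OF s, of y] by metis
  define A B where "A = y 0 + 2 * (w + \<rho>)" and "B = y 1 + 2 * w"
  assume "(\<Sum>c<s. (if c < s then 4 else if c = s then 7 else 8) * y c)
      + (\<Sum>k<length ?L. (if s + k < s then 4 else if s + k = s then 7 else 8) * z k) = 0"
  then have S: "4 * \<sigma> + 7 * w + 8 * \<rho> = 0"
    by (simp add: \<sigma>_def \<rho>_def w_def sum.lessThan_Suc_shift del: sum.lessThan_Suc flip: sum_distrib_left)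
  have nth: "?L ! k \<inter> ?L ! l \<noteq> {}" if "k < Suc t" "l < Suc t" for k l
    using that by (cases k; cases l) auto
  have meet: "(\<Sum>k<Suc t. \<Sum>l<Suc t. if ?L ! k \<inter> ?L ! l \<noteq> {} then z k * z l else 0) = (w + \<rho>)\<^sup>2"
  proof -
    have "(\<Sum>k<Suc t. \<Sum>l<Suc t. if ?L ! k \<inter> ?L ! l \<noteq> {} then z k * z l else 0)
        = (\<Sum>k<Suc t. \<Sum>l<Suc t. z k * z l)"
      using nth by (intro sum.cong refl) auto
    also have "\<dots> = (\<Sum>k<Suc t. z k)\<^sup>2"
      by (simp only: sum_product power2_eq_square)
    finally show ?thesis
      by (simp add: sum.lessThan_Suc_shift w_def \<rho>_def del: sum.lessThan_Suc)
  qed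
  assume "0 \<le> 2 * (\<Sum>c<s. y c)\<^sup>2 - (\<Sum>c<s. (y c)\<^sup>2)
      + 8 * (\<Sum>c<s. y c) * (\<Sum>k<length ?L. z k)
      - 4 * (\<Sum>k<length ?L. z k * (\<Sum>c\<in>?L ! k. y c))
      + 6 * (\<Sum>k<length ?L. z k)\<^sup>2 - 3 * (\<Sum>k<length ?L. (z k)\<^sup>2)
      - 2 * (\<Sum>k<length ?L. \<Sum>l<length ?L.
          if ?L ! k \<inter> ?L ! l \<noteq> {} then z k * z l else 0)"
  also have "\<dots> = 2 * \<sigma>\<^sup>2 - ((y 0)\<^sup>2 + (y 1)\<^sup>2 + c\<^sup>2 + d\<^sup>2) + 8 * \<sigma> * (w + \<rho>)
      - 4 * (w * (y 0 + y 1) + \<rho> * y 0) + 6 * (w + \<rho>)\<^sup>2 - 3 * (w\<^sup>2 + Z) - 2 * (w + \<rho>)\<^sup>2"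
    using meet unfolding cd(2) \<sigma>_def[symmetric]
    by (simp add: sum.lessThan_Suc_shift w_def \<rho>_def Z_def del: sum.lessThan_Suc flip: sum_distrib_right)
  \<comment> \<open>With \<open>S = \<sigma> + 2 (w + \<rho>)\<close>, the form of an arbitrary
    vector is \<open>2 S^2 + w^2 - A^2 - B^2 - c^2 - d^2 - 3 Z\<close>; the hyperplane substitutes
    \<open>w / 4\<close> for \<open>S\<close>.\<close>
  also have "\<dots> = 2 * (w / 4)\<^sup>2 + w\<^sup>2 - A\<^sup>2 - B\<^sup>2 - c\<^sup>2 - d\<^sup>2 - 3 * Z"
  proof -
    have \<sigma>: "\<sigma> = w / 4 - 2 * (w + \<rho>)"
      using S by simp
    show ?thesis
      unfolding \<sigma> A_def B_def by (simp add: power2_eq_square algebra_simps)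
  qed
  finally have form: "0 \<le> 2 * (w / 4)\<^sup>2 + w\<^sup>2 - A\<^sup>2 - B\<^sup>2 - c\<^sup>2 - d\<^sup>2 - 3 * Z" .
  \<comment> \<open>The sum is \<open>S + 2 w\<close>. On the plane \<open>S = 0\<close> with four
    clique vertices, \<open>A = B = c = d = w / 2\<close> and no weight on the pendants make the
    form zero, so that plane fails. With \<open>S = \<epsilon> w\<close>, the estimate for four
    numbers requires \<open>(2 + \<epsilon>)^2 / 4 > 1 + 2 \<epsilon>^2\<close>, that is
    \<open>0 < \<epsilon> < 4/7\<close>; the value 1/4 lies in this range.\<close>
  have "A + B + c + d = 9 / 4 * w"
    using S cd(1) by (simp add: A_def B_def \<sigma>_def)
  moreover have "3 * Z \<ge> 0"
    by (simp add: Z_def sum_nonneg)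
  ultimately have 0: "w = 0" "A = 0" "B = 0" "c = 0" "d = 0" "3 * Z = 0"
    using form_margin[OF _ _ form] by auto
  have z: "z (Suc k) = 0" if "k < t" for k
    using sum_squares_le_0D[of "{..<t}" "\<lambda>k. z (Suc k)" k] that 0(6) by (simp add: Z_def)
  then have "\<rho> = 0"
    by (simp add: \<rho>_def)
  then have "\<forall>i<s. y i = 0"
    using 0 cd(3) by (simp add: A_def B_def)
  moreover have "z k = 0" if "k < length ?L" for k
    using that z 0(1) by (cases k) (auto simp: w_def)
  ultimately show "(\<forall>c<s. y c = 0) \<and> (\<forall>k<length ?L. z k = 0)"
    by blast
qed (use s in \<open>auto simp: nth_Cons'\<close>)

text \<open>The pendant coordinates contribute the remainder \<open>P\<close> already met for two
  stars, and it separates from the part in \<open>w\<close>, \<open>A\<close>, \<open>B\<close>,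
  \<open>c\<close>, \<open>d\<close>. Hence the tilted hyperplane and the limit of two pendants at 0
  beside one at 1 act independently.\<close>

lemma lorentzian_code_theta_both:
  assumes s: "s = 3 \<or> s = 4" and a: "a \<in> {1, 2}"
  shows "lorentzian_code s ({0, 1} # replicate a {0} @ [{1}])"
proof (rule lorentzian_codeI[where w = "\<lambda>v. if v < s then 4 else if v = s then 7 else 8"])
  let ?L = "{0, 1} # replicate a {0} @ [{1}] :: nat set list"
  fix y z :: "nat \<Rightarrow> real"
  define w p q r where "w = z 0" and "p = z 1" and "q = (if a = 2 then z 2 else 0)" and "r = z (Suc a)"
  define \<sigma> where "\<sigma> = (\<Sum>c<s. y c)"
  obtain c d where cd: "(\<Sum>i<s. y i) = y 0 + y 1 + c + d"
    "(\<Sum>i<s. (y i)\<^sup>2) = (y 0)\<^sup>2 + (y 1)\<^sup>2 + c\<^sup>2 + d\<^sup>2"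
    "y 0 = 0 \<Longrightarrow> y 1 = 0 \<Longrightarrow> c = 0 \<Longrightarrow> d = 0 \<Longrightarrow> \<forall>i<s. y i = 0"
    using sum_lessThan_3_4[OF s, of y] by metis
  define A B where "A = y 0 + 2 * (w + p + q)" and "B = y 1 + 2 * (w + r)"
  have sum4: "(\<Sum>c<s. (if c < s then 4 else if c = s then 7 else 8) * y c) = 4 * \<sigma>"
    by (simp add: \<sigma>_def sum_distrib_left)
  define P where "P = 3 * (p + 2 / 3 * r)\<^sup>2 + 3 * (q + 2 / 3 * r)\<^sup>2 + 1 / 3 * r\<^sup>2"
  assume "(\<Sum>c<s. (if c < s then 4 else if c = s then 7 else 8) * y c)
      + (\<Sum>k<length ?L. (if s + k < s then 4 else if s + k = s then 7 else 8) * z k) = 0"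
  then have S: "4 * \<sigma> + 7 * w + 8 * (p + q + r) = 0"
    using a sum4 by (auto simp: w_def p_def q_def r_def numeral_2_eq_2)
  assume "0 \<le> 2 * (\<Sum>c<s. y c)\<^sup>2 - (\<Sum>c<s. (y c)\<^sup>2)
      + 8 * (\<Sum>c<s. y c) * (\<Sum>k<length ?L. z k)
      - 4 * (\<Sum>k<length ?L. z k * (\<Sum>c\<in>?L ! k. y c))
      + 6 * (\<Sum>k<length ?L. z k)\<^sup>2 - 3 * (\<Sum>k<length ?L. (z k)\<^sup>2)
      - 2 * (\<Sum>k<length ?L. \<Sum>l<length ?L.
          if ?L ! k \<inter> ?L ! l \<noteq> {} then z k * z l else 0)"
  \<comment> \<open>Among the outside vertices, only a pendant at 0 and the pendant at 1 have
    disjoint neighbourhoods. This accounts for the correction \<open>2 (p + q) r\<close>, with both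
    orders counted.\<close>
  also have "\<dots> = 2 * \<sigma>\<^sup>2 - ((y 0)\<^sup>2 + (y 1)\<^sup>2 + c\<^sup>2 + d\<^sup>2) + 8 * \<sigma> * (w + p + q + r)
      - 4 * (w * (y 0 + y 1) + (p + q) * y 0 + r * y 1) + 6 * (w + p + q + r)\<^sup>2
      - 3 * (w\<^sup>2 + p\<^sup>2 + q\<^sup>2 + r\<^sup>2) - 2 * ((w + p + q + r)\<^sup>2 - 2 * (p + q) * r)"
    using a unfolding cd(2) \<sigma>_def[symmetric]
    by (auto simp: w_def p_def q_def r_def numeral_2_eq_2 power2_eq_square algebra_simps)
  also have "\<dots> = 2 * (w / 4)\<^sup>2 + w\<^sup>2 - A\<^sup>2 - B\<^sup>2 - c\<^sup>2 - d\<^sup>2 - P"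
  proof -
    have \<sigma>: "\<sigma> = w / 4 - 2 * (w + p + q + r)"
      using S by simp
    show ?thesis
      unfolding \<sigma> A_def B_def P_def by (simp add: power2_eq_square algebra_simps)
  qed
  finally have form: "0 \<le> 2 * (w / 4)\<^sup>2 + w\<^sup>2 - A\<^sup>2 - B\<^sup>2 - c\<^sup>2 - d\<^sup>2 - P" .
  have "A + B + c + d = 9 / 4 * w"
    using S cd(1) by (simp add: A_def B_def \<sigma>_def)
  moreover have "P \<ge> 0"
    by (simp add: P_def)
  ultimately have 0: "w = 0" "A = 0" "B = 0" "c = 0" "d = 0" "P = 0"
    using form_margin[OF _ _ form] by auto
  have "r\<^sup>2 \<le> 0" "(p + 2 / 3 * r)\<^sup>2 \<le> 0" "(q + 2 / 3 * r)\<^sup>2 \<le> 0"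
    using 0(6) zero_le_power2[of "p + 2 / 3 * r"] zero_le_power2[of "q + 2 / 3 * r"] zero_le_power2[of r]
    unfolding P_def by linarith+
  then have "r = 0" "p = 0" "q = 0"
    by auto
  then have "\<forall>i<s. y i = 0"
    using 0 cd(3) by (simp add: A_def B_def)
  moreover have "z k = 0" if "k < length ?L" for k
    using that a 0(1) \<open>p = 0\<close> \<open>q = 0\<close> \<open>r = 0\<close>
    by (auto simp: w_def p_def q_def r_def less_Suc_eq numeral_2_eq_2)
  ultimately show "(\<forall>c<s. y c = 0) \<and> (\<forall>k<length ?L. z k = 0)"
    by blast
qed (use s a in \<open>auto simp: nth_append nth_Cons'\<close>)

lemma lorentzian_named:
  fixes H :: "nat pair_pre_digraph"
  assumes "H = SP1 \<or> H = SP2 \<or> H = B6 \<or> H = B7 \<or> (\<exists>t. H = SP_sup t) \<or> (\<exists>k. H = B_theta k)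
    \<or> (\<exists>s t. s \<ge> 2 \<and> H = clique_pendants s [t])
    \<or> (\<exists>s a. s \<ge> 2 \<and> a \<in> {1, 2} \<and> H = clique_pendants s [a, 1])
    \<or> (\<exists>s t. t \<le> s \<and> H = clique_pendants s (replicate t 1))"
  shows "parcs H \<subseteq> pverts H \<times> pverts H \<and> lorentzian (pverts H) (dist_form H)"
proof -
  have code: ?thesis if "H = split_code s L" "lorentzian_code s L" for s L
    using that parcs_split_code_sub by blast
  show ?thesis
    using assms
  proof (elim disjE exE conjE)
    assume "H = SP1"
    then show ?thesis
      by (intro code[OF _ lorentzian_code_theta_both[of 4 2]]) (simp_all add: SP1_eq_split_code)
  next
    assume "H = SP2"
    then show ?thesis
      by (intro code[OF _ lorentzian_code_theta_both[of 4 1]]) (simp_all add: SP2_eq_split_code)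
  next
    assume "H = B6"
    then show ?thesis
      by (intro code[OF _ lorentzian_code_theta_both[of 3 1]]) (simp_all add: B6_eq_split_code)
  next
    assume "H = B7"
    then show ?thesis
      by (intro code[OF _ lorentzian_code_theta_both[of 3 2]]) (simp_all add: B7_eq_split_code)
  next
    fix t assume "H = SP_sup t"
    then show ?thesis
      by (intro code[OF _ lorentzian_code_theta[of 4 t]]) (simp_all add: SP_sup_eq_split_code)
  next
    fix k assume "H = B_theta k"
    then show ?thesis
      by (intro code[OF _ lorentzian_code_theta[of 3 k]]) (simp_all add: B_theta_eq_split_code)
  next
    fix s t :: nat assume "2 \<le> s" "H = clique_pendants s [t]"
    then show ?thesis
      by (intro code[OF _ lorentzian_code_star[of s t]]) (simp_all add: clique_pendants_single)
  next
    fix s a :: nat assume "2 \<le> s" "a \<in> {1, 2}" "H = clique_pendants s [a, 1]"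
    then show ?thesis
      by (intro code[OF _ lorentzian_code_two_stars[of s a]]) (simp_all only: clique_pendants_pair)
  next
    fix s t :: nat assume "t \<le> s" "H = clique_pendants s (replicate t 1)"
    then show ?thesis
      by (intro code[OF _ lorentzian_code_distinct_pendants[of t s]]) (simp_all only: clique_pendants_ones)
  qed
qed

section \<open>The entries of the form in terms of neighbourhoods\<close>

context connected_split
begin

lemma dist_form_clique: "c \<in> K \<Longrightarrow> d \<in> K \<Longrightarrow> c \<noteq> d \<Longrightarrow> dist_form G c d = 2"
  by (simp add: dist_form_def near_dist_def clique_arc)

lemma dist_form_self [simp]: "dist_form G u u = 1"
  by (simp add: dist_form_def near_dist_def)

lemma dist_form_N: "i \<in> I \<Longrightarrow> c \<in> N i \<Longrightarrow> dist_form G i c = 2"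
  using K_notin_I by (auto simp: dist_form_def near_dist_def N_def)

lemma dist_form_not_N:
  assumes "i \<in> I" "c \<in> K" "c \<notin> N i"
  shows "dist_form G i c = 4"
proof -
  obtain d where "d \<in> N i"
    using N_nonempty assms by blast
  then have "(i, d) \<in> parcs G \<and> (d, c) \<in> parcs G"
    using assms clique_arc by (auto simp: N_def)
  then show ?thesis
    using assms K_notin_I by (auto simp: dist_form_def near_dist_def N_def)
qed

lemma common_neighbour_iff:
  assumes "i \<in> I" "j \<in> I"
  shows "(\<exists>w. (i, w) \<in> parcs G \<and> (w, j) \<in> parcs G) \<longleftrightarrow> N i \<inter> N j \<noteq> {}"
proof
  assume "\<exists>w. (i, w) \<in> parcs G \<and> (w, j) \<in> parcs G"
  then obtain w where w: "(i, w) \<in> parcs G" "(j, w) \<in> parcs G"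
    using arc_sym by blast
  then have "w \<in> K"
    using in_arcsD2[OF w(1)] indep_arc[OF assms(1)] cover by blast
  then show "N i \<inter> N j \<noteq> {}"
    using w by (auto simp: N_def)
next
  assume "N i \<inter> N j \<noteq> {}"
  then obtain c where "(i, c) \<in> parcs G" "(j, c) \<in> parcs G"
    by (auto simp: N_def)
  then show "\<exists>w. (i, w) \<in> parcs G \<and> (w, j) \<in> parcs G"
    using arc_sym by blast
qed

lemma dist_form_meet:
  "i \<in> I \<Longrightarrow> j \<in> I \<Longrightarrow> i \<noteq> j \<Longrightarrow> N i \<inter> N j \<noteq> {} \<Longrightarrow> dist_form G i j = 4"
  using common_neighbour_iff[of i j] by (simp add: dist_form_def near_dist_def indep_arc)

lemma dist_form_disjoint:
  "i \<in> I \<Longrightarrow> j \<in> I \<Longrightarrow> i \<noteq> j \<Longrightarrow> N i \<inter> N j = {} \<Longrightarrow> dist_form G i j = 6"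
  using common_neighbour_iff[of i j] by (simp add: dist_form_def near_dist_def indep_arc)

lemma dist_form_N': "i \<in> I \<Longrightarrow> c \<in> N i \<Longrightarrow> dist_form G c i = 2"
  using dist_form_N dist_form_sym by metis

lemma dist_form_not_N': "i \<in> I \<Longrightarrow> c \<in> K \<Longrightarrow> c \<notin> N i \<Longrightarrow> dist_form G c i = 4"
  using dist_form_not_N dist_form_sym by metis

end

section \<open>Forbidden configurations\<close>

locale lorentzian_split = maximal_split +
  assumes lor: "lorentzian (pverts G) (dist_form G)"
begin

lemmas certificate = lorentzian_certificate[OF fin_V lor dist_form_sym]

lemma I_neq_K: "i \<in> I \<Longrightarrow> c \<in> K \<Longrightarrow> i \<noteq> c" "i \<in> I \<Longrightarrow> c \<in> K \<Longrightarrow> c \<noteq> i"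
  using K_notin_I by auto

lemmas form_simps = K_sub I_sub I_neq_K dist_form_clique dist_form_N dist_form_N' dist_form_not_N
  dist_form_not_N'

text \<open>Below, the coefficient vectors are small integer vectors \<open>y\<close> with \<open>M(y,y) \<ge> M(v,y)\<^sup>2\<close>, found by
  search.\<close>

lemma not_three_one:
  assumes "i \<in> I" "a \<in> N i" "b \<in> N i" "c \<in> N i" "d \<in> K" "d \<notin> N i"
    and "a \<noteq> b" "a \<noteq> c" "b \<noteq> c"
  shows False
proof -
  have *: "a \<in> K" "b \<in> K" "c \<in> K" "a \<noteq> d" "b \<noteq> d" "c \<noteq> d"
    using assms N_sub[of i] by auto
  show False
    \<comment> \<open>Both sides of the strict inequality evaluate to 0.\<close>
    using certificate[of a b "-1" "[(c, -1), (d, 1), (i, 1)]"] assms *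
    by (simp add: form_simps)
qed

text \<open>Once some outside vertex has two neighbours, this bounds the clique by four vertices.
  The certificate is tight, with 16 on both sides.\<close>

lemma not_two_three:
  assumes "i \<in> I" "a \<in> N i" "b \<in> N i" "a \<noteq> b"
    and "c \<in> K" "c \<notin> N i" "d \<in> K" "d \<notin> N i" "e \<in> K" "e \<notin> N i"
      "c \<noteq> d" "c \<noteq> e" "d \<noteq> e"
  shows False
proof -
  have *: "a \<in> K" "b \<in> K" "a \<noteq> c" "a \<noteq> d" "a \<noteq> e" "b \<noteq> c"
      "b \<noteq> d" "b \<noteq> e"
    using assms N_sub[of i] by auto
  show False
    using certificate[of a b "-3" "[(c, 1), (d, 1), (e, 1), (i, 2)]"] assms *
    by (simp add: form_simps)
qed

text \<open>Used for two outside vertices with the same pair of neighbours; maximality of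
  \<open>K\<close> then supplies the vertex \<open>c\<close> that both miss. Both sides of the
  certificate are 16.\<close>

lemma not_two_common:
  assumes "i \<in> I" "j \<in> I" "i \<noteq> j" "a \<in> N i" "a \<in> N j" "b \<in> N i"
      "b \<in> N j" "a \<noteq> b"
    and "c \<in> K" "c \<notin> N i" "c \<notin> N j"
  shows False
proof -
  have *: "a \<in> K" "b \<in> K" "a \<noteq> c" "b \<noteq> c"
    using assms N_sub[of i] by auto
  have "N i \<inter> N j \<noteq> {}"
    using assms by auto
  then have "dist_form G i j = 4" "dist_form G j i = 4"
    using dist_form_meet[of i j] dist_form_sym[of j i] assms by simp_all
  note * = * this
  show False
    using certificate[of a b "-1" "[(c, 1), (i, 1), (j, 1)]"] assms *
    by (simp add: form_simps)
qed

text \<open>Neighbourhoods that meet must therefore be nested. This is the one certificate with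
  slack: 17 against 16.\<close>

lemma not_incomparable:
  assumes "i \<in> I" "j \<in> I" "N i \<inter> N j \<noteq> {}"
    and "c \<in> N i" "c \<notin> N j" "d \<in> N j" "d \<notin> N i"
  shows False
proof -
  have *: "c \<in> K" "d \<in> K" "c \<noteq> d" "i \<noteq> j"
    using assms N_sub[of i] N_sub[of j] by auto
  have "dist_form G i j = 4" "dist_form G j i = 4"
    using dist_form_meet[of i j] dist_form_sym[of j i] assms * by simp_all
  note * = * this
  show False
    using certificate[of c d "-2" "[(i, -2), (j, 1)]"] assms *
    by (simp add: form_simps)
qed

text \<open>It forces the neighbourhood of any other outside vertex to touch the pair of a doubly
  attached one. Both sides of the certificate are 4.\<close>

lemma not_two_disjoint:
  assumes "i \<in> I" "j \<in> I" "N i \<inter> N j = {}" and "a \<in> N i" "b \<in> N i"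
      "a \<noteq> b" "c \<in> N j"
  shows False
proof -
  have *: "a \<in> K" "b \<in> K" "c \<in> K" "c \<notin> N i" "a \<notin> N j" "b \<notin> N j"
      "a \<noteq> c" "b \<noteq> c" "i \<noteq> j"
    using assms N_sub[of i] N_sub[of j] by auto
  have "dist_form G i j = 6" "dist_form G j i = 6"
    using dist_form_disjoint[of i j] dist_form_sym[of j i] assms * by simp_all
  note * = * this
  show False
    using certificate[of a b "-3" "[(c, 3), (i, 3), (j, -1)]"] assms *
    by (simp add: form_simps)
qed

text \<open>Pendants at the same clique vertex contribute the entry 4, pendants at different ones
  the entry 6. The certificate has 16 on both sides. This pattern and the next two leave just
  \<open>K_s(2,1)\<close> when all outside vertices are pendants, two of them share a clique vertex
  and another is attached elsewhere.\<close>

lemma not_pendants_2_2: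
  assumes "i \<in> I" "i' \<in> I" "j \<in> I" "j' \<in> I" "N i = {a}" "N i' = {a}" "N j = {b}"
      "N j' = {b}"
    and "a \<noteq> b" "i \<noteq> i'" "j \<noteq> j'"
  shows False
proof -
  have *: "a \<in> K" "b \<in> K"
    using assms N_sub[of i] N_sub[of j] by auto
  have ne: "i \<noteq> j" "i \<noteq> j'" "i' \<noteq> j" "i' \<noteq> j'"
    using assms by auto
  note * = * this
  have "dist_form G i i' = 4" "dist_form G j j' = 4" "dist_form G i' i = 4" "dist_form G j' j = 4"
    by (rule dist_form_meet; use assms ne in auto)+
  note * = * this
  have "dist_form G i j = 6" "dist_form G i j' = 6" "dist_form G i' j = 6"
      "dist_form G i' j' = 6" "dist_form G j i = 6" "dist_form G j' i = 6"
      "dist_form G j i' = 6" "dist_form G j' i' = 6"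
    by (rule dist_form_disjoint; use assms ne in auto)+
  note * = * this
  show False
    using certificate[of a b "-3" "[(i, -2), (i', -1), (j, 1), (j', 1)]"] assms *
    by (simp add: form_simps)
qed

text \<open>The counterpart of the sign change at three pendants in the two-star form. Both sides of
  the certificate are 36.\<close>

lemma not_pendants_3_1:
  assumes "i \<in> I" "i' \<in> I" "i'' \<in> I" "j \<in> I" "N i = {a}" "N i' = {a}"
      "N i'' = {a}" "N j = {b}"
    and "a \<noteq> b" "i \<noteq> i'" "i \<noteq> i''" "i' \<noteq> i''"
  shows False
proof -
  have *: "a \<in> K" "b \<in> K"
    using assms N_sub[of i] N_sub[of j] by auto
  have ne: "i \<noteq> j" "i' \<noteq> j" "i'' \<noteq> j"
    using assms by auto
  note * = * this
  have "dist_form G i i' = 4" "dist_form G i i'' = 4" "dist_form G i' i'' = 4"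
      "dist_form G i' i = 4" "dist_form G i'' i = 4" "dist_form G i'' i' = 4"
    by (rule dist_form_meet; use assms ne in auto)+
  note * = * this
  have "dist_form G i j = 6" "dist_form G i' j = 6" "dist_form G i'' j = 6"
      "dist_form G j i = 6" "dist_form G j i' = 6" "dist_form G j i'' = 6"
    by (rule dist_form_disjoint; use assms ne in auto)+
  note * = * this
  show False
    using certificate[of a b "-2" "[(i, -1), (i', -1), (i'', -1), (j, 1)]"] assms *
    by (simp add: form_simps)
qed

text \<open>Distinct attachments are harmless in any number by themselves; a third one is fatal once
  a clique vertex carries two pendants. Both sides of the certificate are 16.\<close>

lemma not_pendants_2_1_1:
  assumes "i \<in> I" "i' \<in> I" "j \<in> I" "k \<in> I" "N i = {a}" "N i' = {a}" "N j = {b}"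
      "N k = {c}"
    and "a \<noteq> b" "a \<noteq> c" "b \<noteq> c" "i \<noteq> i'"
  shows False
proof -
  have *: "a \<in> K" "b \<in> K" "c \<in> K"
    using assms N_sub[of i] N_sub[of j] N_sub[of k] by auto
  have ne: "i \<noteq> j" "i \<noteq> k" "i' \<noteq> j" "i' \<noteq> k" "j \<noteq> k"
    using assms by auto
  note * = * this
  have "dist_form G i i' = 4" "dist_form G i' i = 4"
    by (rule dist_form_meet; use assms ne in auto)+
  note * = * this
  have "dist_form G i j = 6" "dist_form G i k = 6" "dist_form G i' j = 6" "dist_form G i' k = 6"
      "dist_form G j k = 6" "dist_form G j i = 6" "dist_form G k i = 6" "dist_form G j i' = 6"
      "dist_form G k i' = 6" "dist_form G k j = 6"
    by (rule dist_form_disjoint; use assms ne in auto)+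
  note * = * this
  show False
    using certificate[of a b "-2" "[(c, -2), (i, -1), (i', -1), (j, 1), (k, 1)]"] assms *
    by (simp add: form_simps)
qed

section \<open>Sizes and mutual positions of the neighbourhoods\<close>

lemma card_N_le_2:
  assumes i: "i \<in> I"
  shows "card (N i) \<le> 2"
proof (rule ccontr)
  assume "\<not> card (N i) \<le> 2"
  then have "3 \<le> card (N i)"
    by simp
  then obtain T where T: "T \<subseteq> N i" "card T = 3"
    by (rule obtain_subset_with_card_n)
  then obtain a b c where "T = {a, b, c}" "a \<noteq> b" "a \<noteq> c" "b \<noteq> c"
    by (auto simp: card_3_iff)
  moreover obtain d where "d \<in> K" "d \<notin> N i"
    using N_psub[OF i] by blast
  ultimately show False
    using not_three_one[OF i, of a b c d] T by auto
qed

text \<open>The lower bound holds because \<open>N i\<close> is a proper subset of \<open>K\<close>;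
  five or more clique vertices would leave three outside \<open>N i\<close>, against
  \<open>not_two_three\<close>.\<close>

lemma card_K_of_double:
  assumes i: "i \<in> I" and N: "N i = {a, b}" and ab: "a \<noteq> b"
  shows "card K = 3 \<or> card K = 4"
proof -
  have "card (N i) < card K"
    using N_psub[OF i] fin_K by (rule psubset_card_mono[rotated])
  then have "card K \<ge> 3"
    using N ab by simp
  moreover have "\<not> card K \<ge> 5"
  proof
    assume "card K \<ge> 5"
    moreover have "card (K - N i) = card K - 2"
      using N_sub[of i] N ab by (simp add: card_Diff_subset)
    ultimately have "3 \<le> card (K - N i)"
      by simp
    then obtain T where T: "T \<subseteq> K - N i" "card T = 3"
      by (rule obtain_subset_with_card_n)
    then obtain c d e where "T = {c, d, e}" "c \<noteq> d" "c \<noteq> e" "d \<noteq> e"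
      by (auto simp: card_3_iff)
    then show False
      using not_two_three[OF i, of a b c d e] T N ab by auto
  qed
  ultimately show ?thesis
    by linarith
qed

lemma singleton_or_double:
  assumes i: "i \<in> I"
  obtains a where "N i = {a}" | a b where "N i = {a, b}" "a \<noteq> b"
proof -
  have "card (N i) \<noteq> 0"
    using N_nonempty[OF i] finite_subset[OF N_sub fin_K] by simp
  then have "card (N i) = 1 \<or> card (N i) = 2"
    using card_N_le_2[OF i] by linarith
  then show ?thesis
    using that by (auto simp: card_1_singleton_iff card_2_iff)
qed

text \<open>The neighbourhood of \<open>j\<close> has to meet the pair. If it is a singleton it lies
  inside the pair; if it has two elements it either equals the pair, against
  \<open>not_two_common\<close>, or, being of the same size, is incomparable with it, against
  \<open>not_incomparable\<close>.\<close>

lemma other_than_double: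
  assumes i: "i \<in> I" and N: "N i = {a, b}" and ab: "a \<noteq> b" and j: "j \<in> I"
      "j \<noteq> i"
  shows "N j = {a} \<or> N j = {b}"
proof (rule ccontr)
  assume neg: "\<not> ?thesis"
  have meet: "N i \<inter> N j \<noteq> {}"
    using not_two_disjoint[OF i j(1), of a b] N ab N_nonempty[OF j(1)] by auto
  obtain c where c: "c \<in> K" "c \<notin> N i"
    using N_psub[OF i] by blast
  show False
  proof (cases rule: singleton_or_double[OF j(1)])
    case (1 x)
    then show False
      using meet N neg by auto
  next
    case (2 x y)
    show False
    proof (cases "N j = N i")
      case True
      then show False
        using not_two_common[OF i j(1) j(2)[symmetric], of a b c] N ab c by simp
    next
      case False
      then have "\<not> N i \<subseteq> N j" "\<not> N j \<subseteq> N i"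
        using 2 N ab by auto
      then obtain p q where "p \<in> N i" "p \<notin> N j" "q \<in> N j" "q \<notin> N i"
        by blast
      then show False
        by (rule not_incomparable[OF i j(1) meet])
    qed
  qed
qed

end

section \<open>Classification\<close>

context connected_split
begin

text \<open>A vertex is sent to its position in \<open>cs @ is\<close>. Comparing membership index
  by index reduces the condition on a code to the positions of a few named clique vertices.\<close>

lemma iso_split_code:
  assumes cs: "distinct cs" "set cs = K" and "is": "distinct is" "set is = I"
    and enc: "list_all2 (\<lambda>i l. \<forall>c<length cs. c \<in> l \<longleftrightarrow> cs ! c \<in> N i) is L"
  shows "G \<simeq>\<^sub>G split_code (length cs) L"
proof -
  define xs where "xs = cs @ is"
  let ?s = "length cs" and ?H = "split_code (length cs) L"
  have len: "length L = length is"
    using enc by (simp add: list_all2_lengthD)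
  have "distinct xs" "set xs = pverts G" "length xs = ?s + length L"
    using cs "is" cover disj len by (auto simp: xs_def)
  then have bij: "bij_betw ((!) xs) (pverts ?H) (pverts G)"
    using bij_betw_nth[of xs "{..<?s + length L}" "pverts G"] by simp
  define f where "f = the_inv_into (pverts ?H) ((!) xs)"
  have f: "bij_betw f (pverts G) (pverts ?H)"
    unfolding f_def by (rule bij_betw_the_inv_into[OF bij])
  have arcs: "(xs ! a, xs ! b) \<in> parcs G \<longleftrightarrow> (a, b) \<in> parcs ?H"
    if ab: "a \<in> pverts ?H" "b \<in> pverts ?H" for a b
  proof -
    have K: "c < ?s \<Longrightarrow> cs ! c \<in> K"
      "c < ?s \<Longrightarrow> xs ! c = cs ! c" for c
      using cs by (auto simp: xs_def nth_append)
    have I: "k < length L \<Longrightarrow> is ! k \<in> I"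
      "k < length L \<Longrightarrow> xs ! (?s + k) = is ! k" for k
      using "is" len by (auto simp: xs_def nth_append)
    have N: "k < length L \<Longrightarrow> c < ?s \<Longrightarrow> c \<in> L ! k \<longleftrightarrow> (is ! k, cs ! c) \<in> parcs G" for c k
      using enc K(1)[of c] len by (auto simp: list_all2_conv_all_nth N_def)
    have split: "(\<exists>c. x = c \<and> c < ?s) \<or> (\<exists>k. x = ?s + k \<and> k < length L)" if "x \<in> pverts ?H" for x
      using that by (cases "x < ?s") (auto intro!: exI[of _ "x - ?s"])
    show ?thesis
      using split[OF ab(1)] split[OF ab(2)]
    proof (elim disjE exE conjE; hypsubst)
      fix c d assume "c < ?s" "d < ?s"
      then show "(xs ! c, xs ! d) \<in> parcs G \<longleftrightarrow> (c, d) \<in> parcs ?H"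
        using K cs by (simp add: clique_arc nth_eq_iff_index_eq)
    next
      fix c k assume "c < ?s" "k < length L"
      then show "(xs ! c, xs ! (?s + k)) \<in> parcs G \<longleftrightarrow> (c, ?s + k) \<in> parcs ?H"
        and "(xs ! (?s + k), xs ! c) \<in> parcs G \<longleftrightarrow> (?s + k, c) \<in> parcs ?H"
        using K I N arc_sym[of "cs ! c" "is ! k"] by simp_all
    next
      fix k l assume "k < length L" "l < length L"
      then show "(xs ! (?s + k), xs ! (?s + l)) \<in> parcs G \<longleftrightarrow> (?s + k, ?s + l) \<in> parcs ?H"
        using I indep_arc by simp
    qed
  qed
  show ?thesis
  proof (rule graph_isoI[OF _ f parcs_split_code_sub])
    show "pair_wf_digraph G"
      by unfold_locales
    fix u v assume "u \<in> pverts G" "v \<in> pverts G"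
    then have "f u \<in> pverts ?H" "f v \<in> pverts ?H" "xs ! f u = u" "xs ! f v = v"
      using f f_the_inv_into_f_bij_betw[OF bij] by (auto simp: bij_betw_def f_def)
    then show "(f u, f v) \<in> parcs ?H \<longleftrightarrow> (u, v) \<in> parcs G"
      using arcs[of "f u" "f v"] by simp
  qed
qed

lemma enumerate_K:
  assumes "distinct ps" "set ps \<subseteq> K"
  obtains qs where "distinct (ps @ qs)" "set (ps @ qs) = K" "length (ps @ qs) = card K"
proof -
  obtain qs where qs: "distinct qs" "set qs = K - set ps"
    using finite_distinct_list[of "K - set ps"] fin_K by auto
  then have "distinct (ps @ qs)" "set (ps @ qs) = K"
    using assms by auto
  then show ?thesis
    using that distinct_card by metis
qed

text \<open>Positions 0 and 1 are the attachment vertices in the named graphs; the equivalences turn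
  membership in \<open>{u}\<close>, \<open>{v}\<close> or \<open>{u, v}\<close> into membership of
  the index in \<open>{0}\<close>, \<open>{1}\<close> or \<open>{0, 1}\<close>.\<close>

lemma enumerate_K_pair:
  assumes "u \<in> K" "v \<in> K" "u \<noteq> v"
  obtains cs where "distinct cs" "set cs = K" "length cs = card K"
    "\<And>c. c < length cs \<Longrightarrow> cs ! c = u \<longleftrightarrow> c = 0" "\<And>c. c < length cs \<Longrightarrow> cs ! c = v \<longleftrightarrow> c = 1"
proof -
  obtain qs where qs: "distinct ([u, v] @ qs)" "set ([u, v] @ qs) = K" "length ([u, v] @ qs) = card K"
    by (rule enumerate_K[of "[u, v]"]) (use assms in auto)
  show ?thesis
  proof (rule that[OF qs])
    fix c assume c: "c < length ([u, v] @ qs)"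
    show "([u, v] @ qs) ! c = u \<longleftrightarrow> c = 0" "([u, v] @ qs) ! c = v \<longleftrightarrow> c = 1"
      using nth_eq_iff_index_eq[OF qs(1) c, of 0] nth_eq_iff_index_eq[OF qs(1) c, of 1] by simp_all
  qed
qed

lemma iso_replicate:
  assumes cs: "distinct (x # qs)"
      "set (x # qs) = K" and N: "\<And>i. i \<in> I \<Longrightarrow> N i = {x}"
  shows "\<exists>t. G \<simeq>\<^sub>G split_code (length (x # qs)) (replicate t {0})"
proof -
  obtain "is" where "is": "distinct is" "set is = I"
    using finite_distinct_list[OF fin_I] by blast
  have "G \<simeq>\<^sub>G split_code (length (x # qs)) (replicate (length is) {0})"
    using cs "is" N
    by (intro iso_split_code[of _ "is"]) (auto simp: list_all2_conv_all_nth nth_Cons')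
  then show ?thesis
    by blast
qed

end

section \<open>Identification of the graph from its system of neighbourhoods\<close>

context lorentzian_split
begin

abbreviation listed :: bool where
  "listed \<equiv>
      (G \<simeq>\<^sub>G SP1 \<or> G \<simeq>\<^sub>G SP2)
    \<or> (G \<simeq>\<^sub>G B6 \<or> G \<simeq>\<^sub>G B7)
    \<or> (\<exists>t. G \<simeq>\<^sub>G SP_sup t)
    \<or> (\<exists>k. G \<simeq>\<^sub>G B_theta k)
    \<or> (\<exists>s t. s \<ge> 2 \<and> G \<simeq>\<^sub>G clique_pendants s [t])
    \<or> (\<exists>s a. s \<ge> 2 \<and> a \<in> {1, 2} \<and> G \<simeq>\<^sub>G clique_pendants s [a, 1])
    \<or> (\<exists>s t. s \<ge> 3 \<and> t \<ge> 3 \<and> t \<le> s \<and> G \<simeq>\<^sub>G clique_pendants s (replicate t 1))"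

text \<open>The set \<open>I\<close> may be empty here; then no pendant is attached and the graph is
  complete.\<close>

lemma classify_one_block:
  assumes x: "x \<in> K" and N: "\<And>i. i \<in> I \<Longrightarrow> N i = {x}"
  shows listed
proof -
  obtain qs where qs: "distinct (x # qs)" "set (x # qs) = K" "length (x # qs) = card K"
    using enumerate_K[of "[x]"] x by auto
  obtain t where "G \<simeq>\<^sub>G split_code (card K) (replicate t {0})"
    using iso_replicate[OF qs(1,2) N] qs(3) by metis
  then have "2 \<le> card K \<and> G \<simeq>\<^sub>G clique_pendants (card K) [t]"
    using card_K by (simp add: clique_pendants_single)
  then show ?thesis
    by blast
qed

lemma classify_injective:
  assumes inj: "inj_on f I" and N: "\<And>i. i \<in> I \<Longrightarrow> N i = {f i}" and "card I \<ge> 2"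
  shows listed
proof -
  obtain "is" where "is": "distinct is" "set is = I"
    using finite_distinct_list[OF fin_I] by blast
  let ?t = "length is"
  have t: "?t \<ge> 2"
    using distinct_card[OF "is"(1)] "is"(2) \<open>card I \<ge> 2\<close> by simp
  have "distinct (map f is)" "set (map f is) \<subseteq> K"
    using inj "is" N N_sub by (auto simp: distinct_map)
  then obtain qs where qs: "distinct (map f is @ qs)" "set (map f is @ qs) = K"
    "length (map f is @ qs) = card K"
    by (rule enumerate_K)
  have s: "?t \<le> card K"
    unfolding qs(3)[symmetric] by simp
  have "G \<simeq>\<^sub>G split_code (length (map f is @ qs)) (map (\<lambda>i. {i}) [0..<?t])"
  proof (rule iso_split_code[OF qs(1,2) "is"], unfold list_all2_conv_all_nth, intro conjI allI impI)
    fix k c assume k: "k < ?t" and c: "c < length (map f is @ qs)"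
    have "(map f is @ qs) ! c = (map f is @ qs) ! k \<longleftrightarrow> c = k"
      using qs(1) c k by (intro nth_eq_iff_index_eq) auto
    moreover have "(map f is @ qs) ! k = f (is ! k)"
      using k by (simp add: nth_append)
    moreover have "N (is ! k) = {f (is ! k)}"
      using k "is" N nth_mem by blast
    ultimately show "c \<in> map (\<lambda>i. {i}) [0..<?t] ! k \<longleftrightarrow> (map f is @ qs) ! c \<in> N (is ! k)"
      using k by simp
  qed simp
  then have iso: "G \<simeq>\<^sub>G split_code (card K) (map (\<lambda>i. {i}) [0..<?t])"
    by (simp only: qs(3))
  show ?thesis
  \<comment> \<open>Two pendants at different vertices form \<open>K_s(1,1)\<close>, which the list
    counts with the pairs; the family of ones starts at three.\<close>
  proof (cases "?t = 2")
    case True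
    then have "map (\<lambda>i. {i}) [0..<?t] = replicate 1 {0} @ [{1}]"
      by (simp add: numeral_2_eq_2)
    then have "2 \<le> card K \<and> (1 :: nat) \<in> {1, 2} \<and> G \<simeq>\<^sub>G clique_pendants (card K) [1, 1]"
      using iso card_K by (simp only: clique_pendants_pair) simp
    then show ?thesis
      by blast
  next
    case False
    then have "3 \<le> card K \<and> 3 \<le> ?t \<and> ?t \<le> card K \<and> G \<simeq>\<^sub>G clique_pendants (card K) (replicate ?t 1)"
      using iso s t by (simp only: clique_pendants_ones) simp
    then show ?thesis
      by blast
  qed
qed

text \<open>A further outside vertex would be attached where \<open>i\<close> and \<open>j\<close>
  are, where \<open>k\<close> is, or at a third clique vertex. These are the three forbidden pendant
  patterns, so \<open>i\<close>, \<open>j\<close>, \<open>k\<close> exhaust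
  \<open>I\<close>.\<close>

lemma classify_two_stars:
  assumes ij: "i \<in> I" "j \<in> I" "i \<noteq> j" "f i = f j" and k: "k \<in> I"
      "f k \<noteq> f i"
    and N: "\<And>i. i \<in> I \<Longrightarrow> N i = {f i}"
  shows listed
proof -
  have "l = i \<or> l = j \<or> l = k" if l: "l \<in> I" for l
  proof (rule ccontr)
    assume neq: "\<not> ?thesis"
    consider "f l = f i" | "f l = f k" | "f l \<noteq> f i" "f l \<noteq> f k"
      by blast
    then show False
    proof cases
      case 1
      then show False
        using not_pendants_3_1[of i j l k "f i" "f k"] ij k l neq N by auto
    next
      case 2
      then show False
        using not_pendants_2_2[of i j k l "f i" "f k"] ij k l neq N by auto
    next
      case 3
      then show False
        using not_pendants_2_1_1[of i j k l "f i" "f k" "f l"] ij k l neq N by auto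
    qed
  qed
  then have "is": "distinct [i, j, k]" "set [i, j, k] = I"
    using ij k by auto
  have "f i \<in> K" "f k \<in> K"
    using N[OF ij(1)] N[OF k(1)] N_sub[of i] N_sub[of k] by auto
  then obtain cs where cs: "distinct cs" "set cs = K" "length cs = card K"
    "\<And>c. c < length cs \<Longrightarrow> cs ! c = f i \<longleftrightarrow> c = 0" "\<And>c. c < length cs \<Longrightarrow> cs ! c = f k \<longleftrightarrow> c = 1"
    using enumerate_K_pair k(2) by metis
  have "N i = {f i}" "N j = {f i}" "N k = {f k}"
    using N ij k by auto
  then have "G \<simeq>\<^sub>G split_code (length cs) [{0}, {0}, {1}]"
    using cs(4,5) by (intro iso_split_code[OF cs(1,2) "is"]) simp
  then have "G \<simeq>\<^sub>G split_code (card K) (replicate 2 {0} @ [{1}])"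
    unfolding cs(3) by (simp add: numeral_2_eq_2)
  then have "2 \<le> card K \<and> (2 :: nat) \<in> {1, 2} \<and> G \<simeq>\<^sub>G clique_pendants (card K) [2, 1]"
    using card_K by (simp only: clique_pendants_pair) simp
  then show ?thesis
    by blast
qed

text \<open>The clique has three or four vertices, and its size decides between
  \<open>B_theta\<close> and \<open>SP_sup\<close>.\<close>

lemma classify_theta:
  assumes w: "w \<in> I" "N w = {u, v}" "u \<noteq> v"
    and N: "\<And>i. i \<in> I \<Longrightarrow> i \<noteq> w \<Longrightarrow> N i = {u}"
  shows listed
proof -
  obtain ps where ps: "distinct ps" "set ps = I - {w}"
    using finite_distinct_list[of "I - {w}"] fin_I by auto
  have "u \<in> K" "v \<in> K"
    using w N_sub[of w] by auto
  then obtain cs where cs: "distinct cs" "set cs = K" "length cs = card K"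
    "\<And>c. c < length cs \<Longrightarrow> cs ! c = u \<longleftrightarrow> c = 0" "\<And>c. c < length cs \<Longrightarrow> cs ! c = v \<longleftrightarrow> c = 1"
    using enumerate_K_pair w(3) by metis
  have "G \<simeq>\<^sub>G split_code (length cs) ({0, 1} # replicate (length ps) {0})"
  proof (rule iso_split_code[OF cs(1,2)])
    show "distinct (w # ps)" "set (w # ps) = I"
      using ps w by auto
    have "N p = {u}" if "p \<in> set ps" for p
      using that ps N by auto
    then show "list_all2 (\<lambda>i l. \<forall>c<length cs. c \<in> l \<longleftrightarrow> cs ! c \<in> N i)
        (w # ps) ({0, 1} # replicate (length ps) {0})"
      using w(2) cs(4,5) by (simp add: list_all2_conv_all_nth[of _ ps])
  qed
  then have "G \<simeq>\<^sub>G split_code (card K) ({0, 1} # replicate (length ps) {0})"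
    by (simp only: cs(3))
  then have "G \<simeq>\<^sub>G SP_sup (length ps) \<or> G \<simeq>\<^sub>G B_theta (length ps)"
    using card_K_of_double[OF w(1) w(2) w(3)]
    by (auto simp: SP_sup_eq_split_code B_theta_eq_split_code)
  then show ?thesis
    by blast
qed

lemma classify_theta_both:
  assumes w: "w \<in> I" "N w = {u, v}" "u \<noteq> v"
    and ps: "distinct ps" "length ps \<in> {1, 2}"
      "\<And>p. p \<in> set ps \<Longrightarrow> N p = {u}"
    and q: "N q = {v}" and I: "I = set (w # ps @ [q])"
  shows listed
proof -
  have "u \<in> K" "v \<in> K"
    using w N_sub[of w] by auto
  then obtain cs where cs: "distinct cs" "set cs = K" "length cs = card K"
    "\<And>c. c < length cs \<Longrightarrow> cs ! c = u \<longleftrightarrow> c = 0" "\<And>c. c < length cs \<Longrightarrow> cs ! c = v \<longleftrightarrow> c = 1"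
    using enumerate_K_pair w(3) by metis
  have "G \<simeq>\<^sub>G split_code (length cs) ({0, 1} # replicate (length ps) {0} @ [{1}])"
  proof (rule iso_split_code[OF cs(1,2)])
    have "w \<notin> set ps" "w \<noteq> q" "q \<notin> set ps"
      using ps(3) w(2,3) q by auto
    then show "distinct (w # ps @ [q])"
      using ps(1) by simp
    show "set (w # ps @ [q]) = I"
      using I by simp
    have "list_all2 (\<lambda>i l. \<forall>c<length cs. c \<in> l \<longleftrightarrow> cs ! c \<in> N i) ps (replicate (length ps) {0})"
      using ps(3) cs(4) by (simp add: list_all2_conv_all_nth)
    then show "list_all2 (\<lambda>i l. \<forall>c<length cs. c \<in> l \<longleftrightarrow> cs ! c \<in> N i)
        (w # ps @ [q]) ({0, 1} # replicate (length ps) {0} @ [{1}])"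
      using w(2) q cs(4,5) by (simp add: list_all2_appendI)
  qed
  then have "G \<simeq>\<^sub>G split_code (card K) ({0, 1} # replicate (length ps) {0} @ [{1}])"
    by (simp only: cs(3))
  then have "G \<simeq>\<^sub>G SP1 \<or> G \<simeq>\<^sub>G SP2 \<or> G \<simeq>\<^sub>G B6 \<or> G \<simeq>\<^sub>G B7"
    using card_K_of_double[OF w(1) w(2) w(3)] ps(2)
    by (auto simp: SP1_eq_split_code SP2_eq_split_code B6_eq_split_code B7_eq_split_code)
  then show ?thesis
    by blast
qed

text \<open>All outside vertices besides \<open>w\<close> are pendants at \<open>u\<close> or at
  \<open>v\<close>. If both kinds occur, there are at most two of each and not two of both, so one
  side has a single pendant; the symmetry between \<open>u\<close> and \<open>v\<close> then leaves
  one pattern.\<close>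

lemma classify_double:
  assumes w: "w \<in> I" "N w = {u, v}" "u \<noteq> v"
  shows listed
proof -
  define P Q where "P = {i \<in> I. N i = {u}}" and "Q = {i \<in> I. N i = {v}}"
  have other: "i \<in> P \<or> i \<in> Q" if "i \<in> I" "i \<noteq> w" for i
    using other_than_double[OF w that] that by (simp add: P_def Q_def)
  have mem: "p \<in> I" "N p = {u}" if "p \<in> P" for p
    using that by (simp_all add: P_def)
  have mem': "q \<in> I" "N q = {v}" if "q \<in> Q" for q
    using that by (simp_all add: Q_def)
  have I: "I = insert w (P \<union> Q)"
    using other mem(1) mem'(1) w(1) by blast
  have fin: "finite P" "finite Q"
    using fin_I by (simp_all add: P_def Q_def)
  have w': "N w = {v, u}" "v \<noteq> u"
    using w by auto
  show ?thesis
  proof (cases "P = {} \<or> Q = {}")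
    case True
    then have "(\<forall>i\<in>I. i \<noteq> w \<longrightarrow> N i = {u}) \<or> (\<forall>i\<in>I. i \<noteq> w \<longrightarrow> N i = {v})"
      using other mem(2) mem'(2) by blast
    then show ?thesis
      using classify_theta[OF w] classify_theta[OF w(1) w'] by blast
  next
    case False
    have small: "card A \<le> 2"
      if A: "A = {i \<in> I. N i = {a}}" and B: "j \<in> I" "N j = {b}" "a \<noteq> b" for A a b j
    proof (rule ccontr)
      assume "\<not> card A \<le> 2"
      then have "3 \<le> card A"
        by simp
      then obtain T where T: "T \<subseteq> A" "card T = 3"
        by (rule obtain_subset_with_card_n)
      then obtain i i' i'' where "T = {i, i', i''}" "i \<noteq> i'" "i \<noteq> i''" "i' \<noteq> i''"
        by (auto simp: card_3_iff)
      then show False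
        using not_pendants_3_1[of i i' i'' j a b] T(1) A B by blast
    qed
    have card1: "card P \<in> {1, 2}" "card Q \<in> {1, 2}"
    proof -
      obtain p q where "p \<in> P" "q \<in> Q"
        using False by blast
      then have "card P \<le> 2" "card Q \<le> 2"
        using small[OF P_def, of q v] small[OF Q_def, of p u] w(3) mem mem' by simp_all
      moreover have "card P \<noteq> 0" "card Q \<noteq> 0"
        using False fin by auto
      ultimately show "card P \<in> {1, 2}" "card Q \<in> {1, 2}"
        by auto
    qed
    have "\<not> (card P = 2 \<and> card Q = 2)"
    proof
      assume "card P = 2 \<and> card Q = 2"
      then obtain i i' j j' where "P = {i, i'}" "i \<noteq> i'" "Q = {j, j'}" "j \<noteq> j'"
        by (auto simp: card_2_iff)
      then show False
        using not_pendants_2_2[of i i' j j' u v] w(3) mem mem' by blast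
    qed
    then have "card P = 1 \<or> card Q = 1"
      using card1 by auto
    then show ?thesis
    proof
      assume "card Q = 1"
      then obtain q where Q: "Q = {q}"
        by (rule card_1_singletonE)
      obtain ps where ps: "distinct ps" "set ps = P"
        using finite_distinct_list[OF fin(1)] by blast
      show ?thesis
      proof (rule classify_theta_both[OF w ps(1)])
        show "length ps \<in> {1, 2}"
          using card1(1) distinct_card[OF ps(1)] ps(2) by simp
        show "N p = {u}" if "p \<in> set ps" for p
          using that ps(2) by (simp add: P_def)
        show "N q = {v}"
          using Q by (auto simp: Q_def)
        show "I = set (w # ps @ [q])"
          using I Q ps(2) by auto
      qed
    next
      assume "card P = 1"
      then obtain p where P: "P = {p}"
        by (rule card_1_singletonE)
      obtain qs where qs: "distinct qs" "set qs = Q"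
        using finite_distinct_list[OF fin(2)] by blast
      show ?thesis
      proof (rule classify_theta_both[OF w(1) w' qs(1)])
        show "length qs \<in> {1, 2}"
          using card1(2) distinct_card[OF qs(1)] qs(2) by simp
        show "N q = {v}" if "q \<in> set qs" for q
          using that qs(2) by (simp add: Q_def)
        show "N p = {u}"
          using P by (auto simp: P_def)
        show "I = set (w # qs @ [p])"
          using I P qs(2) by auto
      qed
    qed
  qed
qed

theorem classification: listed
proof (cases "\<exists>w\<in>I. \<exists>u v. N w = {u, v} \<and> u \<noteq> v")
  case True
  then obtain w u v where w: "w \<in> I" "N w = {u, v}" "u \<noteq> v"
    by blast
  show ?thesis
    by (rule classify_double[OF w])
next
  case False
  have "\<forall>i\<in>I. \<exists>x. N i = {x}"
  proof
    fix i assume i: "i \<in> I"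
    show "\<exists>x. N i = {x}"
    proof (rule singleton_or_double[OF i])
      show ?thesis if "N i = {a}" for a
        using that by (rule exI)
      show ?thesis if "N i = {a, b}" "a \<noteq> b" for a b
        using False i that by metis
    qed
  qed
  then obtain f where "\<forall>i\<in>I. N i = {f i}"
    by (rule bchoice[THEN exE])
  then have f: "N i = {f i}" if "i \<in> I" for i
    using that by blast
  show ?thesis
  \<comment> \<open>Taking \<open>x\<close> from \<open>K\<close> and not from the image of
    \<open>f\<close> makes this case cover an empty \<open>I\<close> too.\<close>
  proof (cases "\<exists>x\<in>K. \<forall>i\<in>I. f i = x")
    case True
    then obtain x where x: "x \<in> K" "\<And>i. i \<in> I \<Longrightarrow> f i = x"
      by blast
    show ?thesis
      by (rule classify_one_block[OF x(1)]) (simp add: f x(2))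
  next
    case nonconst: False
    have fK: "f i \<in> K" if "i \<in> I" for i
      using f[OF that] N_sub[of i] by auto
    show ?thesis
    proof (cases "inj_on f I")
      case True
      have "card I \<ge> 2"
      proof (rule ccontr)
        assume "\<not> card I \<ge> 2"
        then have "card I \<le> Suc 0"
          by simp
        then have single: "i = j" if "i \<in> I" "j \<in> I" for i j
          using fin_I that by (simp add: card_le_Suc0_iff_eq)
        obtain c where "c \<in> K"
          using card_K by fastforce
        then obtain i where i: "i \<in> I"
          using nonconst by blast
        then have "\<forall>j\<in>I. f j = f i"
          using single by blast
        then show False
          using nonconst fK[OF i] by blast
      qed
      with f show ?thesis
        by (rule classify_injective[OF True])
    next
      case False
      then obtain i j where ij: "i \<in> I" "j \<in> I" "i \<noteq> j" "f i = f j"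
        by (auto simp: inj_on_def)
      obtain k where k: "k \<in> I" "f k \<noteq> f i"
        using nonconst fK[OF ij(1)] by blast
      show ?thesis
        by (rule classify_two_stars[OF ij k f])
    qed
  qed
qed

end

theorem theorem5p1:
  fixes G :: "'a pair_pre_digraph" and vs :: "'a list"
  assumes "pair_graph G"
    and "Digraph_Component.connected (with_proj G)"
    and "card (pverts G) \<ge> 2"
    and "split_graph G"
    and "distinct vs" and "set vs = pverts G"
  shows "second_dist_eigenvalue G vs < - 1 / 2 \<longleftrightarrow>
      (G \<simeq>\<^sub>G SP1 \<or> G \<simeq>\<^sub>G SP2)
    \<or> (G \<simeq>\<^sub>G B6 \<or> G \<simeq>\<^sub>G B7)
    \<or> (\<exists>t. G \<simeq>\<^sub>G SP_sup t)
    \<or> (\<exists>k. G \<simeq>\<^sub>G B_theta k)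
    \<or> (\<exists>s t. s \<ge> 2 \<and> G \<simeq>\<^sub>G clique_pendants s [t])
    \<or> (\<exists>s a. s \<ge> 2 \<and> a \<in> {1, 2} \<and> G \<simeq>\<^sub>G clique_pendants s [a, 1])
    \<or> (\<exists>s t. s \<ge> 3 \<and> t \<ge> 3 \<and> t \<le> s \<and> G \<simeq>\<^sub>G clique_pendants s (replicate t 1))"
    (is "_ \<longleftrightarrow> ?R")
proof -
  obtain K I where max: "maximal_split G K I"
    using maximal_split_exists[OF assms(1-4)] .
  then have split: "connected_split G K I"
    by (rule maximal_split.axioms)
  have "second_dist_eigenvalue G vs < - 1 / 2 \<longleftrightarrow> lorentzian (pverts G) (dist_form G)"
    by (rule connected_split.second_dist_eigenvalue_less_iff[OF split assms(5,6)])
  also have "\<dots> \<longleftrightarrow> ?R"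
  proof
    assume "lorentzian (pverts G) (dist_form G)"
    then have "lorentzian_split G K I"
      using max by (intro lorentzian_split.intro lorentzian_split_axioms.intro)
    then show ?R
      by (rule lorentzian_split.classification)
  next
    have fin: "finite (pverts G)"
      by (rule connected_split.fin_V[OF split])
    have wf: "pair_wf_digraph G"
      using assms(1) by (auto simp: pair_graph_def pair_digraph_def pair_fin_digraph_def)
    \<comment> \<open>Only the form is transported along the isomorphism; its meaning in terms of
      distances and eigenvalues is used for \<open>G\<close> alone.\<close>
    have named: "lorentzian (pverts G) (dist_form G)"
      if "G \<simeq>\<^sub>G H" "H = SP1 \<or> H = SP2 \<or> H = B6 \<or> H = B7 \<or> (\<exists>t. H = SP_sup t) \<or> (\<exists>k. H = B_theta k)
        \<or> (\<exists>s t. s \<ge> 2 \<and> H = clique_pendants s [t])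
        \<or> (\<exists>s a. s \<ge> 2 \<and> a \<in> {1, 2} \<and> H = clique_pendants s [a, 1])
        \<or> (\<exists>s t. t \<le> s \<and> H = clique_pendants s (replicate t 1))" for H
      using lorentzian_iso[OF fin wf _ that(1)] lorentzian_named[OF that(2)] by simp
    assume ?R
    then show "lorentzian (pverts G) (dist_form G)"
      by (elim disjE exE conjE) (erule named, metis)+
  qed
  finally show ?thesis .
qed

end
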